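(* Let $G$ be a connected graph with at least $5$ vertices and $\mu_5(G)=\dfrac{1+\sqrt{33}}{2}$. Then $$\mu_6(G)=\begin{cases}\dfrac{3+\sqrt{37}}{2} & \text{if } G=C_5,\\[2mm] \gamma & \text{if } G=C_3*C_3,\\[1mm] \dfrac{3+\sqrt{17}}{2} & \text{if } K_4-e \text{ is an induced subgraph of } G,\\[2mm] 4 & \text{otherwise,}\end{cases}$$ where $\gamma$ is the largest root of $x^3-x^2-11x-7=0$.
   Context: All graphs are finite, undirected, simple and connected. The distance matrix $\mathcal{D}(G)$ of a graph $G$ on vertices $1,\dots,n$ is the $n\times n$ matrix whose $(i,j)$ entry is the length of a shortest path from $i$ to $j$. A real number $\lambda$ is a Pareto eigenvalue of a real $n\times n$ matrix $A$ if there is a nonzero vector $\mathbf{x}\in\mathbb{R}^n$, $\mathbf{x}\ge 0$ (entrywise), with $A\mathbf{x}\ge\lambda\mathbf{x}$ (entrywise) and $\lambda=\frac{\mathbf{x}^TA\mathbf{x}}{\mathbf{x}^T\mathbf{x}}$. The distance Pareto eigenvalues of $G$ are the Pareto eigenvalues of $\mathcal{D}(G)$. $\mu_k(G)$ denotes the $k$-th smallest element of the set of distinct distance Pareto eigenvalues of $G$. $C_n$ is the cycle on $n$ vertices; $C_3*C_3$ is the coalescence of two triangles, i.e. the 5-vertex graph obtained from two disjoint triangles by identifying a vertex of one with a vertex of the other; $K_4-e$ is the complete graph on 4 vertices with one edge removed. Equality of graphs means isomorphism. *)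

theory Defs
  imports
    "HOL-Analysis.Analysis"
    "Graph_Theory.Pair_Digraph"
    "Graph_Theory.Digraph_Isomorphism"
begin

text \<open>Finite simple undirected graphs are the \<open>pair_graph\<close>s (symmetric, loop-free, finite) of
  the entry Graph-Theory. A graph on vertices indexed by a finite type \<open>'n\<close> has vertex set
  \<open>UNIV :: 'n set\<close>, so that its distance matrix is a \<open>real ^ 'n ^ 'n\<close>.\<close>

definition graph_dist :: "'a pair_pre_digraph \<Rightarrow> 'a \<Rightarrow> 'a \<Rightarrow> nat" where
  "graph_dist G u v = (LEAST k. \<exists>p. pre_digraph.apath (with_proj G) u p v \<and> length p = k)"

definition distance_matrix :: "'n::finite pair_pre_digraph \<Rightarrow> real ^ 'n ^ 'n" where
  "distance_matrix G = (\<chi> i j. real (graph_dist G i j))"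

text \<open>The order on vectors is the entrywise one (\<open>less_eq_vec_def\<close>).\<close>

definition pareto_eigenvalue :: "real ^ 'n ^ 'n \<Rightarrow> real \<Rightarrow> bool" where
  "pareto_eigenvalue A l \<longleftrightarrow>
     (\<exists>x. x \<noteq> 0 \<and> 0 \<le> x \<and> l *\<^sub>R x \<le> A *v x \<and> l = (x \<bullet> (A *v x)) / (x \<bullet> x))"

definition distance_pareto_eigenvalues :: "'n::finite pair_pre_digraph \<Rightarrow> real set" where
  "distance_pareto_eigenvalues G = {l. pareto_eigenvalue (distance_matrix G) l}"

text \<open>As a relation, \<open>is_kth_smallest k S x\<close> also asserts that \<open>S\<close> has a \<open>k\<close>-th smallest
  element. The finiteness conjunct is needed because \<open>card\<close> is 0 on infinite sets.\<close>

definition is_kth_smallest :: "nat \<Rightarrow> 'a::linorder set \<Rightarrow> 'a \<Rightarrow> bool" where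
  "is_kth_smallest k S x \<longleftrightarrow>
     x \<in> S \<and> finite {y \<in> S. y < x} \<and> card {y \<in> S. y < x} + 1 = k"

definition is_mu :: "nat \<Rightarrow> 'n::finite pair_pre_digraph \<Rightarrow> real \<Rightarrow> bool" where
  "is_mu k G x \<longleftrightarrow> is_kth_smallest k (distance_pareto_eigenvalues G) x"

definition isomorphic :: "'a pair_pre_digraph \<Rightarrow> 'b pair_pre_digraph \<Rightarrow> bool" where
  "isomorphic G H \<longleftrightarrow> digraph_iso (with_proj G) (with_proj H)"

definition has_induced :: "'a pair_pre_digraph \<Rightarrow> 'b pair_pre_digraph \<Rightarrow> bool" where
  "has_induced G F \<longleftrightarrow>
     (\<exists>H. induced_subgraph (with_proj H) (with_proj G) \<and> isomorphic H F)"

definition undirected :: "'a set \<Rightarrow> 'a rel \<Rightarrow> 'a pair_pre_digraph" where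
  "undirected V E = \<lparr> pverts = V, parcs = E \<union> E\<inverse> \<rparr>"

definition cycle_graph :: "nat \<Rightarrow> nat pair_pre_digraph" where
  "cycle_graph n = undirected {..<n} {(i, (i + 1) mod n) | i. i < n}"

text \<open>The triangles 0, 1, 2 and 0, 3, 4 sharing the vertex 0.\<close>

definition C3_coalescence_C3 :: "nat pair_pre_digraph" where
  "C3_coalescence_C3 = undirected {..<5} {(0,1), (1,2), (2,0), (0,3), (3,4), (4,0)}"

definition K4_minus_e :: "nat pair_pre_digraph" where
  "K4_minus_e = undirected {..<4} ({(i, j). i < j \<and> j < 4} - {(0,1)})"

end

theory Submission
  imports Defs
begin

text \<open>For a matrix with nonnegative entries the complementarity condition in the definition of a
  Pareto eigenvalue says that the eigenvalue has a positive eigenvector on some principal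
  submatrix, and conversely. For symmetric matrices such a value bounds the quadratic form, by
  weighted AM-GM; so it is determined by the index set, monotone in it, and at least the average
  row sum. Hence a principal submatrix of a distance matrix has value at least 4 unless it comes
  from at most three vertices, from \<open>K\<^sub>4\<close> (value 3) or from \<open>K\<^sub>4 - e\<close>. As \<open>G\<close> is not complete, 0, 1, 2 and
  \<open>1 + \<surd>3\<close> always occur, so \<open>\<mu>\<^sub>5 = (1 + \<surd>33) / 2\<close> excludes the value 3, that is, distance 3 and \<open>K\<^sub>4\<close>.
  The value 4 occurs if there is an independent triple or an induced \<open>C\<^sub>4\<close>; without these and
  without \<open>K\<^sub>4 - e\<close>, nonadjacent vertices have exactly one common neighbour, and only
  \<open>C\<^sub>5\<close> and \<open>C\<^sub>3 * C\<^sub>3\<close> remain.\<close>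

section \<open>Pareto eigenvalues and principal submatrices\<close>

text \<open>For a symmetric matrix with positive off-diagonal entries, \<open>perron a S l\<close> says that \<open>l\<close> is the
  spectral radius of the principal submatrix on \<open>S\<close>.\<close>

definition perron :: "('a \<Rightarrow> 'a \<Rightarrow> real) \<Rightarrow> 'a set \<Rightarrow> real \<Rightarrow> bool" where
  "perron a S l \<longleftrightarrow> S \<noteq> {} \<and>
     (\<exists>f. (\<forall>i\<in>S. 0 < f i) \<and> (\<forall>i\<in>S. (\<Sum>j\<in>S. a i j * f j) = l * f i))"

lemma perronI:
  assumes "S \<noteq> {}" "\<And>i. i \<in> S \<Longrightarrow> 0 < f i" "\<And>i. i \<in> S \<Longrightarrow> (\<Sum>j\<in>S. a i j * f j) = l * f i"
  shows "perron a S l"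
  using assms unfolding perron_def by blast

text \<open>With the positive eigenvector \<open>x\<close>, AM-GM bounds \<open>g i * g j\<close> by
  the mean of \<open>(g i)\<^sup>2 * x j / x i\<close> and its mirror image. Symmetry of
  \<open>a\<close> gives both terms the same double sum, and the eigenvector equation bounds its row
  \<open>i\<close> by \<open>l * (g i)\<^sup>2\<close>.\<close>

lemma perron_quadratic_bound:
  fixes a :: "'a \<Rightarrow> 'a \<Rightarrow> real"
  assumes sym: "\<And>i j. a i j = a j i" and nn: "\<And>i j. 0 \<le> a i j"
    and "finite S" "T \<subseteq> S" and l: "perron a S l"
  shows "(\<Sum>i\<in>T. \<Sum>j\<in>T. a i j * (g i * g j)) \<le> l * (\<Sum>i\<in>T. (g i)\<^sup>2)"
proof -
  obtain x where pos: "\<And>i. i \<in> S \<Longrightarrow> 0 < x i"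
    and ev: "\<And>i. i \<in> S \<Longrightarrow> (\<Sum>j\<in>S. a i j * x j) = l * x i"
    using l unfolding perron_def by blast
  let ?w = "\<lambda>i j. a i j * ((g i)\<^sup>2 * x j / x i)"
  have amgm: "a i j * (g i * g j) \<le> (?w i j + ?w j i) / 2" if "i \<in> T" "j \<in> T" for i j
  proof -
    have p: "0 < x i" "0 < x j" using that pos assms by auto
    have "0 \<le> (g i * x j - g j * x i)\<^sup>2 / (x i * x j)" using p by simp
    also have "\<dots> = (g i)\<^sup>2 * x j / x i + (g j)\<^sup>2 * x i / x j - 2 * (g i * g j)"
      using p by (simp add: field_simps power2_eq_square)
    finally have "g i * g j \<le> ((g i)\<^sup>2 * x j / x i + (g j)\<^sup>2 * x i / x j) / 2" by simp
    from mult_left_mono[OF this nn[of i j]] show ?thesis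
      using sym[of i j] by (simp add: algebra_simps add_divide_distrib)
  qed
  have "(\<Sum>i\<in>T. \<Sum>j\<in>T. a i j * (g i * g j)) \<le> (\<Sum>i\<in>T. \<Sum>j\<in>T. (?w i j + ?w j i) / 2)"
    by (intro sum_mono amgm)
  also have "\<dots> = ((\<Sum>i\<in>T. \<Sum>j\<in>T. ?w i j) + (\<Sum>i\<in>T. \<Sum>j\<in>T. ?w j i)) / 2"
    by (simp add: sum.distrib flip: sum_divide_distrib)
  also have "(\<Sum>i\<in>T. \<Sum>j\<in>T. ?w j i) = (\<Sum>i\<in>T. \<Sum>j\<in>T. ?w i j)"
    by (rule sum.swap)
  also have "((\<Sum>i\<in>T. \<Sum>j\<in>T. ?w i j) + (\<Sum>i\<in>T. \<Sum>j\<in>T. ?w i j)) / 2 = (\<Sum>i\<in>T. \<Sum>j\<in>T. ?w i j)"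
    by simp
  also have "\<dots> \<le> (\<Sum>i\<in>T. l * (g i)\<^sup>2)"
  proof (rule sum_mono)
    fix i assume i: "i \<in> T"
    then have p: "0 < x i" and iS: "i \<in> S" using pos assms by auto
    \<comment> \<open>The eigenvector equation sums over all of \<open>S\<close>; passing from
      \<open>T\<close> to \<open>S\<close> adds only nonnegative terms.\<close>
    have "(\<Sum>j\<in>T. ?w i j) \<le> (\<Sum>j\<in>S. ?w i j)"
      using assms pos nn iS by (intro sum_mono2) (auto intro!: mult_nonneg_nonneg divide_nonneg_nonneg intro: less_imp_le)
    also have "\<dots> = (g i)\<^sup>2 / x i * (\<Sum>j\<in>S. a i j * x j)"
      unfolding sum_distrib_left by (intro sum.cong) auto
    also have "\<dots> = l * (g i)\<^sup>2" using p by (simp add: ev[OF iS])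
    finally show "(\<Sum>j\<in>T. ?w i j) \<le> l * (g i)\<^sup>2" .
  qed
  finally show ?thesis by (simp add: sum_distrib_left)
qed

text \<open>The test vector is the eigenvector \<open>y\<close> on \<open>T\<close>, whose quadratic
  form is exactly \<open>m\<close> times its squared norm.\<close>

lemma perron_mono:
  assumes "\<And>i j. a i j = a j i" "\<And>i j. 0 \<le> a i j"
    and "finite S" "T \<subseteq> S" and l: "perron a S l" and m: "perron a T m"
  shows "m \<le> l"
proof -
  obtain y where pos: "\<And>i. i \<in> T \<Longrightarrow> 0 < y i" and "T \<noteq> {}"
    and ev: "\<And>i. i \<in> T \<Longrightarrow> (\<Sum>j\<in>T. a i j * y j) = m * y i"
    using m unfolding perron_def by blast
  have finT: "finite T" using assms finite_subset by blast
  have s: "0 < (\<Sum>i\<in>T. (y i)\<^sup>2)"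
    using pos \<open>T \<noteq> {}\<close> finT by (intro sum_pos) (auto simp: less_imp_neq[symmetric])
  have "(\<Sum>i\<in>T. \<Sum>j\<in>T. a i j * (y i * y j)) = (\<Sum>i\<in>T. y i * (\<Sum>j\<in>T. a i j * y j))"
    by (simp add: sum_distrib_left mult_ac)
  also have "\<dots> = (\<Sum>i\<in>T. m * (y i)\<^sup>2)"
    by (intro sum.cong) (simp_all add: ev power2_eq_square)
  also have "\<dots> = m * (\<Sum>i\<in>T. (y i)\<^sup>2)"
    by (simp only: sum_distrib_left)
  finally have "m * (\<Sum>i\<in>T. (y i)\<^sup>2) \<le> l * (\<Sum>i\<in>T. (y i)\<^sup>2)"
    using perron_quadratic_bound[OF assms(1-4) l, of y] by simp
  then show ?thesis using s by simp
qed

lemma perron_unique: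
  assumes "\<And>i j. a i j = a j i" "\<And>i j. 0 \<le> a i j" "finite S" "perron a S l" "perron a S m"
  shows "l = m"
  using perron_mono[OF assms(1-3) order.refl] assms(4,5) by (meson order.antisym)

text \<open>The constant test vector 1 turns the quadratic bound into a lower bound for
  \<open>l\<close> by the average row sum over any subset.\<close>

lemma perron_average:
  assumes "\<And>i j. a i j = a j i" "\<And>i j. 0 \<le> a i j" "finite S" "T \<subseteq> S" "perron a S l"
  shows "(\<Sum>i\<in>T. \<Sum>j\<in>T. a i j) \<le> l * card T"
  using perron_quadratic_bound[OF assms, of "\<lambda>_. 1"] by simp

lemma pareto_eigenvalue_iff_perron:
  fixes A :: "real ^ 'n ^ 'n"
  assumes nn: "\<And>i j. 0 \<le> A $ i $ j"
  shows "pareto_eigenvalue A l \<longleftrightarrow> (\<exists>S. perron (\<lambda>i j. A $ i $ j) S l)"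
proof
  assume "pareto_eigenvalue A l"
  then obtain x where x: "x \<noteq> 0" "0 \<le> x" "l *\<^sub>R x \<le> A *v x" "l = (x \<bullet> (A *v x)) / (x \<bullet> x)"
    unfolding pareto_eigenvalue_def by blast
  have nx: "0 \<le> x $ i" for i using x(2) by (simp add: less_eq_vec_def)
  let ?y = "A *v x - l *\<^sub>R x"
  have "0 \<le> x $ i * ?y $ i" for i using nx[of i] x(3) by (simp add: less_eq_vec_def)
  \<comment> \<open>The quotient condition makes \<open>x\<close> orthogonal to the residual
    \<open>?y\<close>. Both are nonnegative, so \<open>?y\<close> vanishes on the support of
    \<open>x\<close>, which serves as the index set.\<close>
  moreover have "x \<bullet> ?y = 0"
    using x(1,4) by (simp add: inner_diff_right field_simps)
  then have "(\<Sum>i\<in>UNIV. x $ i * ?y $ i) = 0" by (simp add: inner_vec_def)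
  ultimately have z: "x $ i * ?y $ i = 0" for i
    by (simp add: sum_nonneg_eq_0_iff)
  let ?S = "{i. 0 < x $ i}"
  have xS: "x $ i = 0" if "i \<notin> ?S" for i using that nx[of i] by simp
  have "perron (\<lambda>i j. A $ i $ j) ?S l"
  proof (rule perronI[where f = "\<lambda>i. x $ i"])
    obtain i where "x $ i \<noteq> 0" using x(1) by (metis vec_eq_iff zero_index)
    then show "?S \<noteq> {}" using xS by blast
    fix i assume i: "i \<in> ?S"
    have "(\<Sum>j\<in>?S. A $ i $ j * x $ j) = (\<Sum>j\<in>UNIV. A $ i $ j * x $ j)"
      using xS by (intro sum.mono_neutral_left) auto
    also have "\<dots> = l * x $ i" using z[of i] i by (simp add: matrix_vector_mult_def)
    finally show "(\<Sum>j\<in>?S. A $ i $ j * x $ j) = l * x $ i" .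
  qed auto
  then show "\<exists>S. perron (\<lambda>i j. A $ i $ j) S l" by blast
next
  assume "\<exists>S. perron (\<lambda>i j. A $ i $ j) S l"
  then obtain S f where S: "S \<noteq> {}" and pos: "\<And>i. i \<in> S \<Longrightarrow> 0 < f i"
    and ev: "\<And>i. i \<in> S \<Longrightarrow> (\<Sum>j\<in>S. A $ i $ j * f j) = l * f i"
    unfolding perron_def by blast
  let ?x = "\<chi> i. if i \<in> S then f i else 0"
  have Ax: "(A *v ?x) $ i = (\<Sum>j\<in>S. A $ i $ j * f j)" for i
    by (simp add: matrix_vector_mult_def if_distrib[of "\<lambda>t. _ * t"] sum.If_cases)
  have x0: "?x \<noteq> 0"
  proof
    assume "?x = 0"
    then have "?x $ i = 0" for i by simp
    moreover obtain i where "i \<in> S" using S by blast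
    ultimately show False using pos[of i] by (metis (mono_tags, lifting) less_irrefl vec_lambda_beta)
  qed
  have "0 \<le> ?x" using pos by (auto simp: less_eq_vec_def less_imp_le)
  \<comment> \<open>Outside \<open>S\<close> the left side is 0, so only nonnegativity of the
    entries of \<open>A\<close> is used there.\<close>
  moreover have "l *\<^sub>R ?x \<le> A *v ?x"
    using pos ev nn by (auto simp: less_eq_vec_def Ax less_imp_le intro!: sum_nonneg)
  moreover have "?x \<bullet> (A *v ?x) = l * (?x \<bullet> ?x)"
    unfolding inner_vec_def sum_distrib_left by (intro sum.cong) (auto simp: Ax ev)
  then have "l = (?x \<bullet> (A *v ?x)) / (?x \<bullet> ?x)" using x0 by simp
  ultimately show "pareto_eigenvalue A l" unfolding pareto_eigenvalue_def using x0 by blast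
qed

section \<open>Explicit positive eigenvectors on three and four indices\<close>

lemma perron_isosceles:
  assumes "\<And>i j. a i j = a j i" "distinct [u, v, w]"
    and "a u u = 0" "a v v = 0" "a w w = 0"
    and "a u v = p" "a u w = q" "a v w = q"
    and "0 < q" "p < l" "l * (l - p) = 2 * q\<^sup>2"
  shows "perron a {u, v, w} l"
\<comment> \<open>Rows \<open>u\<close> and \<open>v\<close> hold identically for these weights, and
  row \<open>w\<close> is the quadratic equation assumed for \<open>l\<close>.\<close>
proof (rule perronI[where f = "\<lambda>i. if i = w then l - p else q"])
  fix i assume "i \<in> {u, v, w}"
  then show "(\<Sum>j\<in>{u, v, w}. a i j * (if j = w then l - p else q)) = l * (if i = w then l - p else q)"
    using assms(2-) assms(1)[of v u] assms(1)[of w u] assms(1)[of w v]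
    by (auto simp: algebra_simps power2_eq_square)
qed (use assms in auto)

text \<open>The partition into \<open>{u, v}\<close> and \<open>{w, x}\<close> is equitable: only
  the row and column sums \<open>s\<close> of the off-diagonal block matter. A vector constant on
  each pair reduces the problem to a 2 by 2 quotient matrix, whose characteristic equation is the
  last premise. This covers the diamond, the induced four-cycle and the induced path.\<close>

lemma perron_two_pairs:
  assumes "\<And>i j. a i j = a j i" "distinct [u, v, w, x]"
    and "a u u = 0" "a v v = 0" "a w w = 0" "a x x = 0"
    and "a u v = p" "a w x = r"
    and "a u w + a u x = s" "a v w + a v x = s" "a u w + a v w = s" "a u x + a v x = s"
    and "0 < s" "p < l" "(l - p) * (l - r) = s\<^sup>2"
  shows "perron a {u, v, w, x} l"
proof (rule perronI[where f = "\<lambda>i. if i = w \<or> i = x then l - p else s"])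
  have e: "a u x = s - a u w" "a v w = s - a u w" "a v x = a u w" using assms(9-12) by auto
  fix i assume "i \<in> {u, v, w, x}"
  then show "(\<Sum>j\<in>{u, v, w, x}. a i j * (if j = w \<or> j = x then l - p else s))
      = l * (if i = w \<or> i = x then l - p else s)"
    using assms(2-8,15) assms(1)[of v u] assms(1)[of w u] assms(1)[of w v]
      assms(1)[of x u] assms(1)[of x v] assms(1)[of x w] e
    by (auto simp: algebra_simps power2_eq_square)
qed (use assms in auto)

text \<open>The weights solve the eigenvalue equations at \<open>c\<close> and \<open>p\<close>; the one at \<open>u\<close> is then the cubic.\<close>

lemma perron_paw:
  assumes "\<And>i j. a i j = a j i" "distinct [c, u, v, p]"
    and "a c c = 0" "a u u = 0" "a v v = 0" "a p p = 0"
    and "a c u = 1" "a c v = 1" "a u v = 1" "a c p = 1" "a u p = 2" "a v p = 2"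
    and "1 < l" "l^3 - l^2 - 11 * l - 7 = 0"
  shows "perron a {c, u, v, p} l"
proof (rule perronI[where f = "\<lambda>i. if i = c then 2 * l + 4 else if i = p then 4 * l + 2 else l^2 - 1"])
  fix i assume i: "i \<in> {c, u, v, p}"
  have l3: "l^3 = l^2 + 11 * l + 7" using assms by simp
  have "l * l\<^sup>2 = l\<^sup>2 + 11 * l + 7" using l3 by (simp add: power3_eq_cube power2_eq_square)
  then show "(\<Sum>j\<in>{c, u, v, p}. a i j * (if j = c then 2 * l + 4 else if j = p then 4 * l + 2 else l^2 - 1))
      = l * (if i = c then 2 * l + 4 else if i = p then 4 * l + 2 else l^2 - 1)"
    using i assms(2-12) assms(1)[of u c] assms(1)[of v c] assms(1)[of p c]
      assms(1)[of v u] assms(1)[of p u] assms(1)[of p v]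
    by (auto simp: algebra_simps power2_eq_square)
next
  have "1 < l\<^sup>2" using assms by (simp add: one_less_power)
  then show "0 < (if i = c then 2 * l + 4 else if i = p then 4 * l + 2 else l^2 - 1)"
    if "i \<in> {c, u, v, p}" for i using assms by auto
qed auto

section \<open>Successive smallest elements and numerical bounds\<close>

lemma is_kth_smallest_Suc:
  assumes "is_kth_smallest k S x" "y \<in> S" "x < y" "\<And>z. z \<in> S \<Longrightarrow> z \<le> x \<or> y \<le> z"
  shows "is_kth_smallest (Suc k) S y"
proof -
  \<comment> \<open>No element of \<open>S\<close> lies strictly between \<open>x\<close> and
    \<open>y\<close>, so exactly one element is added below.\<close>
  have "{z \<in> S. z < y} = insert x {z \<in> S. z < x}"
    using assms unfolding is_kth_smallest_def by (auto simp: order.strict_iff_order dest: order.antisym) 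
  then show ?thesis using assms unfolding is_kth_smallest_def by simp
qed

lemma sqrt_bounds:
  shows "1 < sqrt 3" "sqrt 3 < 2"
    and "5 < sqrt 33" "sqrt 33 < 6" "4 < sqrt 17" "sqrt 17 < 5" "6 < sqrt 37"
  by (auto intro!: real_less_rsqrt real_less_lsqrt)

lemma sqrt_33_less: "(1 + sqrt 33) / 2 < (3 + sqrt 17) / 2"
proof -
  have "sqrt 33 < 2 + sqrt 17"
    using sqrt_bounds by (intro real_less_lsqrt) (auto simp: power2_eq_square algebra_simps)
  then show ?thesis by simp
qed

lemma Max_cubic_roots:
  defines "c \<equiv> Max {x::real. x^3 - x^2 - 11 * x - 7 = 0}"
  shows "c^3 - c^2 - 11 * c - 7 = 0" "4 < c" "c < 5"
proof -
  let ?p = "\<lambda>x::real. x^3 - x^2 - 11 * x - 7"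
  let ?R = "{x::real. ?p x = 0}"
  have "?R = {x. poly [:-7, -11, -1, 1:] x = 0}"
    by (auto simp: power3_eq_cube power2_eq_square algebra_simps)
  then have fin: "finite ?R" using poly_roots_finite[of "[:-7, -11, -1, 1::real:]"] by simp
  \<comment> \<open>The cubic is -3 at 4 and 38 at 5.\<close>
  have "\<exists>x\<ge>4. x \<le> 5 \<and> ?p x = 0"
    by (intro IVT') (auto intro!: continuous_intros)
  then obtain x where x: "4 \<le> x" "?p x = 0" by blast
  then have "x \<le> c" unfolding c_def using fin by simp
  have "c \<in> ?R" unfolding c_def using fin x(2) by (intro Max_in) auto
  then show c: "?p c = 0" by simp
  have "c \<noteq> 4" using c by auto
  then show "4 < c" using x(1) \<open>x \<le> c\<close> by simp
  \<comment> \<open>In the form \<open>c * (c * (c - 1) - 11) = 7\<close> the equation fails from 5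
    on, where the left side is at least 45.\<close>
  show "c < 5"
  proof (rule ccontr)
    assume "\<not> c < 5"
    then have "5 \<le> c" by simp
    moreover have "9 \<le> c * (c - 1) - 11" using mult_mono[of 5 c 4 "c - 1"] \<open>5 \<le> c\<close> by simp
    ultimately have "5 * 9 \<le> c * (c * (c - 1) - 11)" by (intro mult_mono) auto
    also have "\<dots> = 7" using c by (simp add: power3_eq_cube power2_eq_square algebra_simps)
    finally show False by simp
  qed
qed

section \<open>Distances in connected graphs\<close>

text \<open>Each step of \<open>awalk_to_apath\<close> cuts out a cycle, which never lengthens the
  walk. Hence shortest walks are as short as shortest paths.\<close>

lemma (in wf_digraph) length_awalk_to_apath:
  assumes "awalk u p v"
  shows "length (awalk_to_apath p) \<le> length p"
  using assms
proof (induct rule: awalk_to_apath_induct)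
  case (path p)
  then have "awalk_to_apath p = p" by (auto simp: awalk_to_apath.simps)
  then show ?case by simp
next
  case (decomp p q r s)
  then have "awalk_to_apath p = awalk_to_apath (q @ s)"
    using step_awalk_to_apath[of _ p _ q r s] by simp
  moreover have "length (q @ s) \<le> length p"
    using decomp by (auto elim!: awalk_cyc_decompE)
  ultimately show ?case using decomp by simp
qed

text \<open>Relation powers make reversal and splitting off the last edge easy. The premise on
  \<open>u\<close> matters for \<open>k = 0\<close>, since even the empty walk must start at a
  vertex.\<close>

lemma (in pair_wf_digraph) relpow_iff_awalk:
  assumes "u \<in> pverts G"
  shows "(u, v) \<in> parcs G ^^ k \<longleftrightarrow> (\<exists>p. awalk u p v \<and> length p = k)"
  using assms
proof (induction k arbitrary: u)
  case 0
  then show ?case by (auto simp: awalk_Nil_iff)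
next
  case (Suc k)
  have "(u, v) \<in> parcs G ^^ Suc k \<longleftrightarrow> (\<exists>w. (u, w) \<in> parcs G \<and> (w, v) \<in> parcs G ^^ k)"
    by (rule iffI) (blast dest: relpow_Suc_D2, blast intro: relpow_Suc_I2)
  also have "\<dots> \<longleftrightarrow> (\<exists>w p. (u, w) \<in> parcs G \<and> awalk w p v \<and> length p = k)"
    using Suc.IH in_arcsD2 by blast
  also have "\<dots> \<longleftrightarrow> (\<exists>p. awalk u p v \<and> length p = Suc k)"
  proof
    assume "\<exists>w p. (u, w) \<in> parcs G \<and> awalk w p v \<and> length p = k"
    then obtain w p where "(u, w) \<in> parcs G" "awalk w p v" "length p = k" by blast
    then have "awalk u ((u, w) # p) v \<and> length ((u, w) # p) = Suc k"
      using Suc.prems by (simp add: awalk_Cons_iff)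
    then show "\<exists>p. awalk u p v \<and> length p = Suc k" by blast
  next
    assume "\<exists>p. awalk u p v \<and> length p = Suc k"
    then obtain e p where "awalk u (e # p) v" "length p = k" by (metis length_Suc_conv)
    then show "\<exists>w p. (u, w) \<in> parcs G \<and> awalk w p v \<and> length p = k"
      by (cases e) (auto simp: awalk_Cons_iff)
  qed
  finally show ?case .
qed

lemma graph_dist_eq_Least_relpow:
  assumes "pair_wf_digraph G" "u \<in> pverts G"
  shows "graph_dist G u v = (LEAST k. (u, v) \<in> parcs G ^^ k)"
proof -
  interpret pair_wf_digraph G by fact
  let ?P = "\<lambda>k. \<exists>p. apath u p v \<and> length p = k" and ?Q = "\<lambda>k. \<exists>p. awalk u p v \<and> length p = k"
  have PQ: "?P k \<Longrightarrow> ?Q k" for k using awalkI_apath by blast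
  have QP: "\<exists>k'\<le>k. ?P k'" if "?Q k" for k
    using that apath_awalk_to_apath length_awalk_to_apath by blast
  have "(LEAST k. ?P k) = (LEAST k. ?Q k)"
  proof (cases "\<exists>k. ?Q k")
    case True
    define m where "m = (LEAST k. ?Q k)"
    have q: "?Q m" unfolding m_def using True by (rule LeastI_ex)
    have least: "m \<le> k" if "?P k" for k
      unfolding m_def using PQ[OF that] by (rule Least_le)
    obtain k' where k': "k' \<le> m" "?P k'" using QP[OF q] by blast
    have "k' = m" using least[OF k'(2)] k'(1) by (rule order.antisym[rotated])
    then have "?P m" using k'(2) by simp
    then have "(LEAST k. ?P k) = m" using least by (rule Least_equality)
    then show ?thesis unfolding m_def .
  next
    \<comment> \<open>Without a walk both predicates are constantly false, so the two unspecified
      \<open>LEAST\<close> values agree.\<close>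
    case False
    then have "?P = ?Q" using PQ by blast
    then show ?thesis by simp
  qed
  then show ?thesis
    unfolding graph_dist_def relpow_iff_awalk[OF assms(2)] .
qed

locale spanning_connected_graph = pair_graph G for G :: "'n::finite pair_pre_digraph" +
  assumes verts: "pverts G = UNIV" and conn: "Digraph_Component.connected (with_proj G)"
begin

definition adj :: "'n \<Rightarrow> 'n \<Rightarrow> bool" where "adj u v \<longleftrightarrow> (u, v) \<in> parcs G"

abbreviation d :: "'n \<Rightarrow> 'n \<Rightarrow> nat" where "d \<equiv> graph_dist G"

lemma adj_sym: "adj u v \<Longrightarrow> adj v u"
  unfolding adj_def by (rule arcs_symmetric)

lemma not_adj_self [simp]: "\<not> adj u u"
  unfolding adj_def using no_loops' by blast

lemma dist_Least: "d u v = (LEAST k. (u, v) \<in> parcs G ^^ k)"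
  by (rule graph_dist_eq_Least_relpow) (use verts in \<open>auto intro: pair_wf_digraph\<close>)

lemma ex_relpow: "\<exists>k. (u, v) \<in> parcs G ^^ k"
proof -
  have "u \<rightarrow>\<^sup>*\<^bsub>mk_symmetric G\<^esub> v"
    using conn verts unfolding connected_def strongly_connected_def by auto
  \<comment> \<open>Connectedness speaks of the symmetric closure; reachability there is the same as
    in \<open>G\<close>, whose arcs are symmetric.\<close>
  then have "u \<rightarrow>\<^sup>*\<^bsub>G\<^esub> v" using sym_arcs by (simp only: reachable_mk_symmetric_eq)
  then obtain p where "awalk u p v" unfolding reachable_awalk by blast
  then show ?thesis using relpow_iff_awalk verts by blast
qed

lemma relpow_dist: "(u, v) \<in> parcs G ^^ d u v"
  using LeastI_ex[OF ex_relpow[of u v]] by (simp only: dist_Least)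

lemma dist_le: "(u, v) \<in> parcs G ^^ k \<Longrightarrow> d u v \<le> k"
  unfolding dist_Least by (rule Least_le)

lemma dist_eq_0_iff [simp]: "d u v = 0 \<longleftrightarrow> u = v"
  using relpow_dist[of u v] dist_le[of u v 0] by auto

lemma dist_eq_1_iff: "d u v = 1 \<longleftrightarrow> adj u v"
proof
  assume "d u v = 1"
  with relpow_dist[of u v] show "adj u v" by (simp add: adj_def)
next
  assume a: "adj u v"
  then have "d u v \<le> 1" using dist_le[of u v 1] by (simp add: adj_def)
  moreover have "d u v \<noteq> 0" using a by auto
  ultimately show "d u v = 1" by linarith
qed

lemma relpow_sym: "(u, v) \<in> parcs G ^^ k \<Longrightarrow> (v, u) \<in> parcs G ^^ k"
proof (induction k arbitrary: u)
  case (Suc k)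
  then obtain w where "(u, w) \<in> parcs G" "(w, v) \<in> parcs G ^^ k"
    by (meson relpow_Suc_D2)
  then show ?case using Suc.IH arcs_symmetric by (blast intro: relpow_Suc_I)
qed simp

lemma dist_sym: "d u v = d v u"
  by (meson dist_le order.antisym relpow_dist relpow_sym)

text \<open>The last vertex before \<open>v\<close> on a shortest walk: it is at distance at most
  \<open>k\<close> by that walk, and a smaller distance would shorten the way to
  \<open>v\<close>.\<close>

lemma dist_Suc:
  assumes "d u v = Suc k"
  obtains w where "d u w = k" "adj w v"
proof -
  have "(u, v) \<in> parcs G ^^ Suc k" using relpow_dist[of u v] assms by simp
  then obtain w where w: "(u, w) \<in> parcs G ^^ k" "(w, v) \<in> parcs G" by (meson relpow_Suc_E)
  have "Suc (d u w) \<ge> d u v" using relpow_dist[of u w] w(2) by (intro dist_le) auto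
  with dist_le[OF w(1)] assms have "d u w = k" by simp
  with w(2) show thesis by (intro that) (auto simp: adj_def)
qed

text \<open>Moving \<open>v\<close> back along a shortest walk lowers the distance by one each time.
  This turns lower bounds on a distance into vertices at distance exactly 2 or 3.\<close>

lemma ex_dist_eq:
  assumes "k \<le> d u v"
  shows "\<exists>w. d u w = k"
  using assms
proof (induction "d u v - k" arbitrary: v)
  case 0
  then show ?case by auto
next
  case (Suc m)
  then obtain j where "d u v = Suc j" by (cases "d u v") auto
  then obtain w where w: "d u w = j" by (rule dist_Suc)
  have "m = d u w - k" "k \<le> d u w" using Suc.hyps(2) \<open>d u v = Suc j\<close> w by linarith+
  then show ?case by (rule Suc.hyps(1))
qed

lemma dist_eq_2D:
  assumes "d u v = 2"
  shows "u \<noteq> v" "\<not> adj u v" "\<exists>w. adj u w \<and> adj w v"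
proof -
  show "u \<noteq> v" using assms dist_eq_0_iff[of u v] by linarith
  show "\<not> adj u v" using assms dist_eq_1_iff[of u v] by linarith
  obtain w where "d u w = 1" "adj w v" using dist_Suc[of u v 1] assms by auto
  then show "\<exists>w. adj u w \<and> adj w v" using dist_eq_1_iff by blast
qed

end

section \<open>Isomorphisms and induced subgraphs as vertex maps\<close>

lemma isomorphic_iff:
  assumes "pair_wf_digraph G" "pair_wf_digraph H"
  shows "isomorphic G H \<longleftrightarrow> (\<exists>g. bij_betw g (pverts H) (pverts G) \<and>
    (\<forall>i\<in>pverts H. \<forall>j\<in>pverts H. (g i, g j) \<in> parcs G \<longleftrightarrow> (i, j) \<in> parcs H))"
proof -
  interpret G: pair_wf_digraph G by fact
  interpret H: pair_wf_digraph H by fact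
  show ?thesis
  proof
    assume "isomorphic G H"
    then obtain h where h: "G.digraph_isomorphism h" and H: "with_proj H = app_iso h (with_proj G)"
      unfolding isomorphic_def digraph_iso_def by blast
    let ?f = "iso_verts h"
    have vH: "pverts H = ?f ` pverts G" using arg_cong[OF H, of verts] by simp
    have aH: "parcs H = iso_arcs h ` parcs G" using arg_cong[OF H, of arcs] by simp
    \<comment> \<open>Tail and head of \<open>with_proj H\<close> are the projections, so the vertex
      map determines the arc map.\<close>
    have tH: "iso_tail h = fst" "iso_head h = snd"
      using arg_cong[OF H, of tail] arg_cong[OF H, of head] by simp_all
    have inj: "inj_on ?f (pverts G)" using h unfolding G.digraph_isomorphism_def by simp
    have arc: "iso_arcs h (u, v) = (?f u, ?f v)" if "(u, v) \<in> parcs G" for u v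
      using h that unfolding G.digraph_isomorphism_def tH by (auto simp: prod_eq_iff)
    have arcs: "(?f u, ?f v) \<in> parcs H \<longleftrightarrow> (u, v) \<in> parcs G" if "u \<in> pverts G" "v \<in> pverts G" for u v
    proof
      assume "(?f u, ?f v) \<in> parcs H"
      then obtain u' v' where p: "(u', v') \<in> parcs G" "(?f u, ?f v) = (?f u', ?f v')"
        unfolding aH using arc by auto
      then have "u = u'" "v = v'" using that inj G.wellformed' by (auto dest: inj_onD)
      with p show "(u, v) \<in> parcs G" by simp
    qed (use arc aH in force)
    let ?g = "the_inv_into (pverts G) ?f"
    have g: "bij_betw ?g (pverts H) (pverts G)"
      unfolding vH using inj by (simp add: bij_betw_the_inv_into inj_on_imp_bij_betw)
    have fg: "?f (?g i) = i" if "i \<in> pverts H" for i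
      using that inj unfolding vH by (simp add: f_the_inv_into_f)
    have "(?g i, ?g j) \<in> parcs G \<longleftrightarrow> (i, j) \<in> parcs H" if "i \<in> pverts H" "j \<in> pverts H" for i j
      using arcs[of "?g i" "?g j"] that g fg by (auto simp: bij_betw_apply)
    with g show "\<exists>g. bij_betw g (pverts H) (pverts G) \<and>
      (\<forall>i\<in>pverts H. \<forall>j\<in>pverts H. (g i, g j) \<in> parcs G \<longleftrightarrow> (i, j) \<in> parcs H)" by blast
  next
    assume "\<exists>g. bij_betw g (pverts H) (pverts G) \<and>
      (\<forall>i\<in>pverts H. \<forall>j\<in>pverts H. (g i, g j) \<in> parcs G \<longleftrightarrow> (i, j) \<in> parcs H)"
    then obtain g where g: "bij_betw g (pverts H) (pverts G)"
      and arcs: "\<And>i j. i \<in> pverts H \<Longrightarrow> j \<in> pverts H \<Longrightarrow> (g i, g j) \<in> parcs G \<longleftrightarrow> (i, j) \<in> parcs H"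
      by blast
    let ?f = "the_inv_into (pverts H) g"
    have f: "bij_betw ?f (pverts G) (pverts H)" using g by (rule bij_betw_the_inv_into)
    have gf: "g (?f u) = u" if "u \<in> pverts G" for u
      using that g by (metis bij_betw_def f_the_inv_into_f)
    have fg: "?f (g i) = i" if "i \<in> pverts H" for i
      using that g by (metis bij_betw_def the_inv_into_f_f)
    let ?h = "\<lparr> iso_verts = ?f, iso_arcs = map_prod ?f ?f, iso_head = snd, iso_tail = fst \<rparr>"
    have inj: "inj_on ?f (pverts G)" using f by (rule bij_betw_imp_inj_on)
    have "inj_on (map_prod ?f ?f) (parcs G)"
      using map_prod_inj_on[OF inj inj] by (rule inj_on_subset) (auto dest: G.wellformed')
    then have "G.digraph_isomorphism ?h"
      unfolding G.digraph_isomorphism_def using inj G.wf_digraph_axioms by auto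
    moreover have "map_prod ?f ?f ` parcs G = parcs H"
    proof (intro set_eqI iffI)
      fix e assume "e \<in> map_prod ?f ?f ` parcs G"
      then obtain u v where uv: "(u, v) \<in> parcs G" "e = (?f u, ?f v)" by auto
      then have "u \<in> pverts G" "v \<in> pverts G" by (auto dest: G.wellformed')
      with uv arcs[of "?f u" "?f v"] f gf show "e \<in> parcs H" by (auto simp: bij_betw_apply)
    next
      fix e assume e: "e \<in> parcs H"
      obtain i j where ij: "e = (i, j)" by force
      with e have v: "i \<in> pverts H" "j \<in> pverts H" by (auto dest: H.wellformed')
      with e ij arcs have "(g i, g j) \<in> parcs G" by simp
      moreover have "e = map_prod ?f ?f (g i, g j)" using fg v ij by simp
      ultimately show "e \<in> map_prod ?f ?f ` parcs G" by (rule rev_image_eqI)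
    qed
    then have "with_proj H = app_iso ?h (with_proj G)"
      using f unfolding app_iso_def with_proj_def by (simp add: bij_betw_def)
    ultimately show "isomorphic G H" unfolding isomorphic_def digraph_iso_def by blast
  qed
qed

lemma has_induced_iff:
  assumes "pair_wf_digraph G" "pair_wf_digraph F"
  shows "has_induced G F \<longleftrightarrow> (\<exists>g. inj_on g (pverts F) \<and> g ` pverts F \<subseteq> pverts G \<and>
    (\<forall>i\<in>pverts F. \<forall>j\<in>pverts F. (g i, g j) \<in> parcs G \<longleftrightarrow> (i, j) \<in> parcs F))"
proof
  assume "has_induced G F"
  then obtain H where H: "induced_subgraph (with_proj H) (with_proj G)" "isomorphic H F"
    unfolding has_induced_def by blast
  then have wf: "pair_wf_digraph H" and sub: "pverts H \<subseteq> pverts G"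
    and arcs: "parcs H = {e \<in> parcs G. fst e \<in> pverts H \<and> snd e \<in> pverts H}"
    unfolding induced_subgraph_def subgraph_def wf_digraph_wp_iff[symmetric] by auto
  from H(2) obtain g where g: "bij_betw g (pverts F) (pverts H)"
    "\<forall>i\<in>pverts F. \<forall>j\<in>pverts F. (g i, g j) \<in> parcs H \<longleftrightarrow> (i, j) \<in> parcs F"
    unfolding isomorphic_iff[OF wf assms(2)] by blast
  have gH: "g i \<in> pverts H" if "i \<in> pverts F" for i using that g(1) by (rule bij_betw_apply[rotated])
  then have "\<forall>i\<in>pverts F. \<forall>j\<in>pverts F. (g i, g j) \<in> parcs G \<longleftrightarrow> (i, j) \<in> parcs F"
    using g(2) unfolding arcs by simp
  moreover have "g ` pverts F \<subseteq> pverts G" using gH sub by blast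
  ultimately show "\<exists>g. inj_on g (pverts F) \<and> g ` pverts F \<subseteq> pverts G \<and>
    (\<forall>i\<in>pverts F. \<forall>j\<in>pverts F. (g i, g j) \<in> parcs G \<longleftrightarrow> (i, j) \<in> parcs F)"
    using bij_betw_imp_inj_on[OF g(1)] by blast
next
  assume "\<exists>g. inj_on g (pverts F) \<and> g ` pverts F \<subseteq> pverts G \<and>
    (\<forall>i\<in>pverts F. \<forall>j\<in>pverts F. (g i, g j) \<in> parcs G \<longleftrightarrow> (i, j) \<in> parcs F)"
  then obtain g where g: "inj_on g (pverts F)" "g ` pverts F \<subseteq> pverts G"
    "\<forall>i\<in>pverts F. \<forall>j\<in>pverts F. (g i, g j) \<in> parcs G \<longleftrightarrow> (i, j) \<in> parcs F" by blast
  let ?V = "g ` pverts F"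
  \<comment> \<open>The witness is the subgraph of \<open>G\<close> induced on the image of
    \<open>g\<close>.\<close>
  let ?H = "\<lparr> pverts = ?V, parcs = {e \<in> parcs G. fst e \<in> ?V \<and> snd e \<in> ?V} \<rparr>"
  have wf: "pair_wf_digraph ?H" by unfold_locales auto
  then have "induced_subgraph (with_proj ?H) (with_proj G)"
    using g(2) assms(1) unfolding induced_subgraph_def subgraph_def wf_digraph_wp_iff compatible_def
    by auto
  moreover have "isomorphic ?H F"
    unfolding isomorphic_iff[OF wf assms(2)] using g by (intro exI[of _ g]) (auto simp: bij_betw_def)
  ultimately show "has_induced G F" unfolding has_induced_def by blast
qed

section \<open>The distance spectrum\<close>

text \<open>The complement of \<open>S\<close> has at most one element \<open>z\<close>; the listed
  four-element set that avoids \<open>z\<close> lies in \<open>S\<close>.\<close>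

lemma four_subset_of_five:
  fixes S :: "'a set"
  assumes U: "UNIV = {a, b, c, e, f :: 'a}" and ne: "distinct [a, b, c, e, f]" and S: "4 \<le> card S"
  shows "{a, b, c, e} \<subseteq> S \<or> {a, b, c, f} \<subseteq> S \<or> {a, b, e, f} \<subseteq> S \<or> {a, c, e, f} \<subseteq> S
    \<or> {b, c, e, f} \<subseteq> S"
proof -
  have "card (UNIV :: 'a set) = 5" using ne unfolding U by simp
  moreover have "finite (UNIV :: 'a set)" unfolding U by simp
  then have fin: "finite A" for A :: "'a set" by (rule finite_subset[OF subset_UNIV])
  ultimately have "card (- S) \<le> 1" using S by (simp add: Compl_eq_Diff_UNIV card_Diff_subset fin)
  then have "\<exists>z. - S \<subseteq> {z}"
    by (metis One_nat_def card_le_Suc0_iff_eq fin singletonI subsetI)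
  then obtain z where "- S \<subseteq> {z}" by blast
  then have sub: "T \<subseteq> S" if "z \<notin> T" for T using that by blast
  have "z \<in> {a, b, c, e, f}" using U by blast
  then have "z \<notin> {a, b, c, e} \<or> z \<notin> {a, b, c, f} \<or> z \<notin> {a, b, e, f} \<or> z \<notin> {a, c, e, f}
    \<or> z \<notin> {b, c, e, f}"
    using ne by (elim insertE emptyE) auto
  then show ?thesis by (elim disj_forward) (erule sub)+
qed

section \<open>The concrete graphs and their labellings\<close>

lemma lessThan_4_5: "{..<4::nat} = {0, 1, 2, 3}" "{..<5::nat} = {0, 1, 2, 3, 4}"
  by auto

lemma pair_wf_digraph_cycle_graph: "pair_wf_digraph (cycle_graph n)"
  by unfold_locales (auto simp: cycle_graph_def undirected_def)

lemma pair_wf_digraph_C3_coalescence_C3: "pair_wf_digraph C3_coalescence_C3"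
  by unfold_locales (auto simp: C3_coalescence_C3_def undirected_def)

lemma pair_wf_digraph_K4_minus_e: "pair_wf_digraph K4_minus_e"
  by unfold_locales (auto simp: K4_minus_e_def undirected_def)

lemma parcs_cycle_graph_5:
  "parcs (cycle_graph 5) =
    {(0, 1), (1, 2), (2, 3), (3, 4), (4, 0), (1, 0), (2, 1), (3, 2), (4, 3), (0, 4)}"
proof -
  have "{(i, (i + 1) mod 5) | i. i < (5::nat)} = (\<lambda>i. (i, (i + 1) mod 5)) ` {..<5}"
    by blast
  also have "\<dots> = {(0, 1), (1, 2), (2, 3), (3, 4), (4, 0)}"
    unfolding lessThan_4_5 by (simp add: numeral_2_eq_2)
  finally show ?thesis by (auto simp: cycle_graph_def undirected_def)
qed

text \<open>This trades a bijection from the labels for five named vertices, so that isomorphism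
  with a concrete graph becomes a list of adjacencies. For the converse, list indexing is the
  bijection.\<close>

lemma ex_bij_betw_5_iff:
  "(\<exists>g. bij_betw g {..<5::nat} (UNIV :: 'a set) \<and> P (g 0) (g 1) (g 2) (g 3) (g 4)) \<longleftrightarrow>
   (\<exists>a b c e f. UNIV = {a, b, c, e, f} \<and> distinct [a, b, c, e, f] \<and> P a b c e f)"
proof
  assume "\<exists>g. bij_betw g {..<5::nat} (UNIV :: 'a set) \<and> P (g 0) (g 1) (g 2) (g 3) (g 4)"
  then obtain g where g: "bij_betw g {..<5::nat} (UNIV :: 'a set)" "P (g 0) (g 1) (g 2) (g 3) (g 4)"
    by blast
  have "UNIV = {g 0, g 1, g 2, g 3, g 4}"
    using bij_betw_imp_surj_on[OF g(1)] unfolding lessThan_4_5 by (simp add: numeral_2_eq_2)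
  moreover have "distinct [g 0, g 1, g 2, g 3, g 4]"
    using bij_betw_imp_inj_on[OF g(1)] unfolding lessThan_4_5 inj_on_def by simp
  ultimately show "\<exists>a b c e f. UNIV = {a, b, c, e, f} \<and> distinct [a, b, c, e, f] \<and> P a b c e f"
    using g(2) by blast
next
  assume "\<exists>a b c e f. UNIV = {a, b, c, e, f} \<and> distinct [a, b, c, e, f] \<and> P a b c e f"
  then obtain a b c e f where U: "(UNIV :: 'a set) = {a, b, c, e, f}"
    and ne: "distinct [a, b, c, e, f]" and P: "P a b c e f" by blast
  have "bij_betw ((!) [a, b, c, e, f]) {..<5} UNIV"
    unfolding U using ne by (intro bij_betw_nth) auto
  moreover have "P ([a, b, c, e, f] ! 0) ([a, b, c, e, f] ! 1) ([a, b, c, e, f] ! 2)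
      ([a, b, c, e, f] ! 3) ([a, b, c, e, f] ! 4)"
    using P by simp
  ultimately show "\<exists>g. bij_betw g {..<5::nat} (UNIV :: 'a set) \<and> P (g 0) (g 1) (g 2) (g 3) (g 4)"
    by blast
qed

section \<open>Eigenvalues of distance submatrices\<close>

context spanning_connected_graph
begin

abbreviation D :: "'n \<Rightarrow> 'n \<Rightarrow> real" where "D \<equiv> \<lambda>i j. real (d i j)"

lemma D_sym: "D i j = D j i"
  by (simp add: dist_sym)

lemma D_nonneg: "0 \<le> D i j"
  by simp

lemmas D_mono = perron_mono[of D, OF D_sym D_nonneg finite]
  and D_unique = perron_unique[of D, OF D_sym D_nonneg finite]
  and D_average = perron_average[of D, OF D_sym D_nonneg finite]
  and D_isosceles = perron_isosceles[of D, OF D_sym]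
  and D_two_pairs = perron_two_pairs[of D, OF D_sym]
  and D_paw = perron_paw[of D, OF D_sym]

abbreviation spectrum :: "real set" where "spectrum \<equiv> distance_pareto_eigenvalues G"

lemma spectrum_iff: "l \<in> spectrum \<longleftrightarrow> (\<exists>S. perron D S l)"
  unfolding distance_pareto_eigenvalues_def
  by (simp add: pareto_eigenvalue_iff_perron distance_matrix_def)

lemma spectrumI: "perron D S l \<Longrightarrow> l \<in> spectrum"
  unfolding spectrum_iff by blast

lemma dist_ge_1: "i \<noteq> j \<Longrightarrow> 1 \<le> d i j"
  using dist_eq_0_iff[of i j] by linarith

lemma dist_adj: "adj u v \<Longrightarrow> d u v = 1"
  by (simp only: dist_eq_1_iff)

lemma perron_singleton: "perron D {u} 0"
  by (rule perronI[where f = "\<lambda>_. 1"]) auto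

lemma perron_pair: "u \<noteq> v \<Longrightarrow> perron D {u, v} (D u v)"
  by (rule perronI[where f = "\<lambda>_. 1"]) (auto simp: dist_sym)

text \<open>Off-diagonal distances are at least 1, so every row sum on \<open>S\<close> is at least
  \<open>card S - 1\<close>. In particular five vertices force a value of at least 4.\<close>

lemma card_le_perron:
  assumes "perron D S l"
  shows "real (card S) - 1 \<le> l"
proof -
  have "S \<noteq> {}" using assms unfolding perron_def by blast
  then have c: "0 < card S" by (simp add: card_gt_0_iff)
  have "real (card S) - 1 \<le> (\<Sum>j\<in>S. D i j)" if "i \<in> S" for i
  proof -
    have "real (card S) - 1 = (\<Sum>j\<in>S - {i}. 1)" using that c by (simp add: of_nat_diff)
    also have "\<dots> \<le> (\<Sum>j\<in>S - {i}. D i j)"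
    proof (intro sum_mono)
      fix j assume "j \<in> S - {i}"
      then show "1 \<le> D i j" using dist_ge_1[of i j] by auto
    qed
    also have "\<dots> \<le> (\<Sum>j\<in>S. D i j)" by (intro sum_mono2) auto
    finally show ?thesis .
  qed
  then have "(\<Sum>i\<in>S. real (card S) - 1) \<le> (\<Sum>i\<in>S. \<Sum>j\<in>S. D i j)" by (intro sum_mono)
  also have "\<dots> \<le> l * card S" using D_average[OF order.refl assms] .
  finally show ?thesis using c by (simp add: mult.commute)
qed

lemma perron_ge_average4:
  assumes "perron D S l" "distinct [u, v, w, x]" "{u, v, w, x} \<subseteq> S"
  shows "D u v + D u w + D u x + D v w + D v x + D w x \<le> 2 * l"
  \<comment> \<open>The double sum counts each distance twice and the index set has four elements,
    hence the factor 2.\<close>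
  using D_average[OF assms(3,1)] assms(2)
  by (simp add: dist_sym[of v u] dist_sym[of w u] dist_sym[of x u] dist_sym[of w v]
      dist_sym[of x v] dist_sym[of x w])

lemma perron_complete:
  assumes "S \<noteq> {}" "\<And>i j. i \<in> S \<Longrightarrow> j \<in> S \<Longrightarrow> i \<noteq> j \<Longrightarrow> adj i j"
  shows "perron D S (real (card S) - 1)"
proof (rule perronI[where f = "\<lambda>_. 1"])
  fix i assume i: "i \<in> S"
  have "0 < card S" using assms(1) by (simp add: card_gt_0_iff)
  have "(\<Sum>j\<in>S. D i j * 1) = (\<Sum>j\<in>S - {i}. D i j)"
    using i sum.remove[of S i "\<lambda>j. D i j"] by simp
  also have "\<dots> = (\<Sum>j\<in>S - {i}. 1)"
    using assms(2) i by (intro sum.cong) (auto simp: dist_adj)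
  also have "\<dots> = real (card S) - 1" using i \<open>0 < card S\<close> by (simp add: of_nat_diff)
  finally show "(\<Sum>j\<in>S. D i j * 1) = (real (card S) - 1) * 1" by simp
qed (use assms in auto)

text \<open>In a complete graph every eigenvalue is an integer \<open>card S - 1\<close>, but
  \<open>(1 + sqrt 33) / 2\<close> lies strictly between 3 and 4.\<close>

lemma ex_nonadjacent:
  assumes "(1 + sqrt 33) / 2 \<in> spectrum"
  shows "\<exists>u v. u \<noteq> v \<and> \<not> adj u v"
proof (rule ccontr)
  assume complete: "\<not> ?thesis"
  obtain S where S: "perron D S ((1 + sqrt 33) / 2)" using assms spectrum_iff by blast
  have "S \<noteq> {}" using S unfolding perron_def by blast
  then have "perron D S (real (card S) - 1)"
    by (rule perron_complete) (use complete in blast)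
  with S have "(1 + sqrt 33) / 2 = real (card S) - 1" by (rule D_unique)
  then have c: "real (card S) = (3 + sqrt 33) / 2" by (simp add: field_simps)
  have "real 4 < real (card S)" "real (card S) < real 5" unfolding c using sqrt_bounds by simp_all
  then show False by simp
qed

lemma ex_dist_2:
  assumes "u \<noteq> v" "\<not> adj u v"
  shows "\<exists>w. d u w = 2"
proof -
  have "2 \<le> d u v" using assms dist_ge_1[of u v] dist_eq_1_iff[of u v] by linarith
  then show ?thesis by (rule ex_dist_eq)
qed

text \<open>All four values live on an induced path with ends \<open>u\<close>, \<open>v\<close>: a
  vertex, an edge, the two ends, and the whole path, whose equation is
  \<open>l * (l - 2) = 2\<close>.\<close>

lemma small_eigenvalues:
  assumes "d u v = 2"
  shows "{0, 1, 2, 1 + sqrt 3} \<subseteq> spectrum"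
proof -
  obtain w where w: "adj u w" "adj w v" using dist_eq_2D(3)[OF assms] by blast
  have ne: "u \<noteq> v" "u \<noteq> w" "v \<noteq> w" using dist_eq_2D(1)[OF assms] w by auto
  have dw: "d u w = 1" "d v w = 1" using w dist_adj adj_sym by auto
  have "perron D {u, v, w} (1 + sqrt 3)"
    using ne assms dw sqrt_bounds
    by (intro D_isosceles[where p = 2 and q = 1]) (auto simp: algebra_simps)
  moreover have "perron D {u, v} 2" using perron_pair[OF ne(1)] assms by simp
  moreover have "perron D {u, w} 1" using perron_pair[OF ne(2)] dw by simp
  ultimately show ?thesis using perron_singleton[of u] by (auto intro: spectrumI)
qed

text \<open>Only four eigenvalues lie below the fifth, and 0, 1, 2 and \<open>1 + sqrt 3\<close> are
  already four; 3 would be another one.\<close>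

lemma three_not_eigenvalue:
  assumes mu: "is_mu 5 G ((1 + sqrt 33) / 2)"
  shows "3 \<notin> spectrum"
proof
  assume "3 \<in> spectrum"
  let ?B = "{y \<in> spectrum. y < (1 + sqrt 33) / 2}"
  have B: "finite ?B" "card ?B = 4" and m: "(1 + sqrt 33) / 2 \<in> spectrum"
    using mu unfolding is_mu_def is_kth_smallest_def by auto
  obtain u v where "d u v = 2" using ex_nonadjacent[OF m] ex_dist_2 by blast
  then have "insert (1 + sqrt 3) {0, 1, 2, 3} \<subseteq> ?B"
    using small_eigenvalues \<open>3 \<in> spectrum\<close> sqrt_bounds by auto
  then have "card (insert (1 + sqrt 3) {0, 1, 2, 3}) \<le> 4" using B card_mono by metis
  moreover have "1 + sqrt 3 \<notin> {0, 1, 2, 3}" using sqrt_bounds(1,2) by (simp; linarith)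
  then have "card (insert (1 + sqrt 3) {0, 1, 2, 3}) = 5" by (subst card_insert_disjoint) auto
  ultimately show False by simp
qed

section \<open>Small vertex configurations\<close>

definition clique4 :: "'n \<Rightarrow> 'n \<Rightarrow> 'n \<Rightarrow> 'n \<Rightarrow> bool" where
  "clique4 u v w x \<longleftrightarrow> adj u v \<and> adj u w \<and> adj u x \<and> adj v w \<and> adj v x \<and> adj w x"

text \<open>The pair \<open>u\<close>, \<open>v\<close> corresponds to the removed edge of
  \<open>K4_minus_e\<close>. Only the nonadjacent pair needs an explicit inequality, as adjacency is
  irreflexive.\<close>

definition diamond :: "'n \<Rightarrow> 'n \<Rightarrow> 'n \<Rightarrow> 'n \<Rightarrow> bool" where
  "diamond u v w x \<longleftrightarrow>
     u \<noteq> v \<and> \<not> adj u v \<and> adj u w \<and> adj u x \<and> adj v w \<and> adj v x \<and> adj w x"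

definition induced_C4 :: "'n \<Rightarrow> 'n \<Rightarrow> 'n \<Rightarrow> 'n \<Rightarrow> bool" where
  "induced_C4 u v w x \<longleftrightarrow>
     u \<noteq> v \<and> w \<noteq> x \<and> \<not> adj u v \<and> \<not> adj w x \<and> adj u w \<and> adj u x \<and> adj v w \<and> adj v x"

definition independent3 :: "'n \<Rightarrow> 'n \<Rightarrow> 'n \<Rightarrow> bool" where
  "independent3 u v w \<longleftrightarrow>
     u \<noteq> v \<and> u \<noteq> w \<and> v \<noteq> w \<and> \<not> adj u v \<and> \<not> adj u w \<and> \<not> adj v w"

lemma clique4_imp_three:
  assumes "clique4 u v w x"
  shows "3 \<in> spectrum"
proof -
  have dist: "distinct [u, v, w, x]" using assms unfolding clique4_def by auto
  have "perron D {u, v, w, x} (real (card {u, v, w, x}) - 1)"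
    using assms adj_sym unfolding clique4_def by (intro perron_complete) auto
  moreover have "card {u, v, w, x} = 4" using dist by auto
  ultimately show ?thesis by (auto intro: spectrumI)
qed

text \<open>The vertices are in cyclic order, and the clause on \<open>UNIV\<close> makes this a
  description of the whole graph.\<close>

definition pentagon :: "'n \<Rightarrow> 'n \<Rightarrow> 'n \<Rightarrow> 'n \<Rightarrow> 'n \<Rightarrow> bool" where
  "pentagon a b c e f \<longleftrightarrow> UNIV = {a, b, c, e, f} \<and> distinct [a, b, c, e, f] \<and>
     adj a b \<and> adj b c \<and> adj c e \<and> adj e f \<and> adj f a \<and>
     \<not> adj a c \<and> \<not> adj a e \<and> \<not> adj b e \<and> \<not> adj b f \<and> \<not> adj c f"

definition bowtie :: "'n \<Rightarrow> 'n \<Rightarrow> 'n \<Rightarrow> 'n \<Rightarrow> 'n \<Rightarrow> bool" where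
  "bowtie a b c e f \<longleftrightarrow> UNIV = {a, b, c, e, f} \<and> distinct [a, b, c, e, f] \<and>
     adj a b \<and> adj b c \<and> adj a c \<and> adj a e \<and> adj e f \<and> adj a f \<and>
     \<not> adj b e \<and> \<not> adj b f \<and> \<not> adj c e \<and> \<not> adj c f"

lemma adj_commute: "adj u v \<longleftrightarrow> adj v u"
  using adj_sym by blast

text \<open>Among three vertices of a five-cycle two are consecutive. This rules out the triples of
  value 4, which is smaller than \<open>(3 + sqrt 37) / 2\<close>.\<close>

lemma pentagon_no_independent3:
  assumes "pentagon a b c e f"
  shows "\<not> independent3 u v w"
proof -
  have "u \<in> {a, b, c, e, f}" "v \<in> {a, b, c, e, f}" "w \<in> {a, b, c, e, f}"
    using assms unfolding pentagon_def by blast+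
  then show ?thesis using assms unfolding pentagon_def independent3_def
    by (elim insertE emptyE) (simp_all add: adj_commute)
qed

text \<open>Two of any three vertices lie in a common triangle.\<close>

lemma bowtie_no_independent3:
  assumes "bowtie a b c e f"
  shows "\<not> independent3 u v w"
proof -
  have "u \<in> {a, b, c, e, f}" "v \<in> {a, b, c, e, f}" "w \<in> {a, b, c, e, f}"
    using assms unfolding bowtie_def by blast+
  then show ?thesis using assms unfolding bowtie_def independent3_def
    by (elim insertE emptyE) (simp_all add: adj_commute)
qed

lemma parcs_iff: "(u, v) \<in> parcs G \<longleftrightarrow> adj u v"
  by (simp add: adj_def)

lemma isomorphic_cycle_graph_5_iff:
  "isomorphic G (cycle_graph 5) \<longleftrightarrow> (\<exists>a b c e f. pentagon a b c e f)"
proof -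
  let ?P = "\<lambda>a b c e f. adj a b \<and> adj b c \<and> adj c e \<and> adj e f \<and> adj f a \<and>
     \<not> adj a c \<and> \<not> adj a e \<and> \<not> adj b e \<and> \<not> adj b f \<and> \<not> adj c f"
  have "isomorphic G (cycle_graph 5) \<longleftrightarrow> (\<exists>g. bij_betw g {..<5::nat} (UNIV :: 'n set) \<and>
    (\<forall>i\<in>{..<5}. \<forall>j\<in>{..<5}. adj (g i) (g j) \<longleftrightarrow> (i, j) \<in> parcs (cycle_graph 5)))"
    unfolding isomorphic_iff[OF pair_wf_digraph pair_wf_digraph_cycle_graph] verts parcs_iff
    by (simp add: cycle_graph_def undirected_def)
  also have "\<dots> \<longleftrightarrow> (\<exists>g. bij_betw g {..<5::nat} (UNIV :: 'n set) \<and>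
     ?P (g 0) (g 1) (g 2) (g 3) (g 4))"
    unfolding lessThan_4_5 ball_simps
    by (intro ex_cong1 conj_cong[OF refl]) (auto simp: parcs_cycle_graph_5 adj_commute)
  also have "\<dots> \<longleftrightarrow> (\<exists>a b c e f. pentagon a b c e f)"
    unfolding pentagon_def by (rule ex_bij_betw_5_iff[of ?P])
  finally show ?thesis .
qed

lemma isomorphic_C3_coalescence_C3_iff:
  "isomorphic G C3_coalescence_C3 \<longleftrightarrow> (\<exists>a b c e f. bowtie a b c e f)"
proof -
  let ?P = "\<lambda>a b c e f. adj a b \<and> adj b c \<and> adj a c \<and> adj a e \<and> adj e f \<and> adj a f \<and>
     \<not> adj b e \<and> \<not> adj b f \<and> \<not> adj c e \<and> \<not> adj c f"
  have "isomorphic G C3_coalescence_C3 \<longleftrightarrow> (\<exists>g. bij_betw g {..<5::nat} (UNIV :: 'n set) \<and>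
    (\<forall>i\<in>{..<5}. \<forall>j\<in>{..<5}. adj (g i) (g j) \<longleftrightarrow> (i, j) \<in> parcs C3_coalescence_C3))"
    unfolding isomorphic_iff[OF pair_wf_digraph pair_wf_digraph_C3_coalescence_C3] verts parcs_iff
    by (simp add: C3_coalescence_C3_def undirected_def)
  also have "\<dots> \<longleftrightarrow> (\<exists>g. bij_betw g {..<5::nat} (UNIV :: 'n set) \<and>
     ?P (g 0) (g 1) (g 2) (g 3) (g 4))"
    unfolding lessThan_4_5 ball_simps
    by (intro ex_cong1 conj_cong[OF refl]) (auto simp: C3_coalescence_C3_def undirected_def adj_commute)
  also have "\<dots> \<longleftrightarrow> (\<exists>a b c e f. bowtie a b c e f)"
    unfolding bowtie_def by (rule ex_bij_betw_5_iff[of ?P])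
  finally show ?thesis .
qed

lemma has_induced_K4_minus_e_iff:
  "has_induced G K4_minus_e \<longleftrightarrow> (\<exists>u v w x. diamond u v w x)"
proof -
  have "has_induced G K4_minus_e \<longleftrightarrow> (\<exists>g :: nat \<Rightarrow> 'n. inj_on g {..<4} \<and>
    (\<forall>i\<in>{..<4}. \<forall>j\<in>{..<4}. adj (g i) (g j) \<longleftrightarrow> (i, j) \<in> parcs K4_minus_e))"
    unfolding has_induced_iff[OF pair_wf_digraph pair_wf_digraph_K4_minus_e] verts parcs_iff
    by (simp add: K4_minus_e_def undirected_def)
  also have "\<dots> \<longleftrightarrow> (\<exists>g :: nat \<Rightarrow> 'n. diamond (g 0) (g 1) (g 2) (g 3))"
    unfolding lessThan_4_5 ball_simps diamond_def
    by (intro ex_cong1) (auto simp: inj_on_def K4_minus_e_def undirected_def adj_commute)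
  also have "\<dots> \<longleftrightarrow> (\<exists>u v w x. diamond u v w x)"
  proof
    assume "\<exists>u v w x. diamond u v w x"
    then obtain u v w x where "diamond u v w x" by blast
    then have "diamond ([u, v, w, x] ! 0) ([u, v, w, x] ! 1) ([u, v, w, x] ! 2) ([u, v, w, x] ! 3)"
      by simp
    then show "\<exists>g :: nat \<Rightarrow> 'n. diamond (g 0) (g 1) (g 2) (g 3)" by blast
  qed blast
  finally show ?thesis .
qed

end

section \<open>Graphs of diameter two without four-cliques\<close>

locale diameter_2_K4_free = spanning_connected_graph G for G :: "'n::finite pair_pre_digraph" +
  assumes diam: "u \<noteq> v \<Longrightarrow> \<not> adj u v \<Longrightarrow> d u v = 2" and K4_free: "\<not> clique4 u v w x"
begin

lemma common_neighbour:
  assumes "u \<noteq> v" "\<not> adj u v"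
  obtains w where "adj u w" "adj w v"
  using dist_eq_2D(3)[OF diam[OF assms]] by blast

lemma dist_cases: "u \<noteq> v \<Longrightarrow> d u v = 1 \<or> d u v = 2"
  using diam dist_eq_1_iff by blast

text \<open>The pairs are the nonadjacent vertices and the adjacent ones, with equation
  \<open>(l - 2) * (l - 1) = 4\<close>.\<close>

lemma diamond_perron:
  assumes "diamond u v w x"
  shows "perron D {u, v, w, x} ((3 + sqrt 17) / 2)"
proof -
  have "d u v = 2" "d u w = 1" "d u x = 1" "d v w = 1" "d v x = 1" "d w x = 1"
    "distinct [u, v, w, x]"
    using assms diam unfolding diamond_def by (auto simp: dist_adj)
  then show ?thesis using sqrt_bounds
    by (intro D_two_pairs[where p = 2 and r = 1 and s = 2])
      (auto simp: field_simps power2_eq_square)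
qed

lemma four_in_spectrum:
  assumes "independent3 u v w \<or> induced_C4 u v w x"
  shows "4 \<in> spectrum"
  using assms
proof
  assume "independent3 u v w"
  then have "d u v = 2" "d u w = 2" "d v w = 2" "distinct [u, v, w]"
    using diam unfolding independent3_def by auto
  then have "perron D {u, v, w} 4" by (intro D_isosceles[where p = 2 and q = 2]) auto
  then show ?thesis by (rule spectrumI)
next
  assume "induced_C4 u v w x"
  then have "d u v = 2" "d w x = 2" "d u w = 1" "d u x = 1" "d v w = 1" "d v x = 1"
    "distinct [u, v, w, x]"
    using diam unfolding induced_C4_def by (auto simp: dist_adj)
  then have "perron D {u, v, w, x} 4"
    by (intro D_two_pairs[where p = 2 and r = 2 and s = 2]) auto
  then show ?thesis by (rule spectrumI)
qed

text \<open>Two of the three distances agree, since each is 1 or 2. The four isosceles types have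
  the values 2, \<open>(1 + sqrt 33) / 2\<close>, \<open>1 + sqrt 3\<close> and 4, the last only
  when all distances are 2.\<close>

lemma perron_triple_cases:
  assumes l: "perron D {u, v, w} l" and ne: "distinct [u, v, w]"
  shows "l \<le> (1 + sqrt 33) / 2 \<or> (l = 4 \<and> independent3 u v w)"
proof -
  have iso: "l \<le> (1 + sqrt 33) / 2 \<or> (d x y = 2 \<and> d x z = 2 \<and> d y z = 2 \<and> l = 4)"
    if xyz: "distinct [x, y, z]" "{u, v, w} = {x, y, z}" "d x z = d y z" for x y z
  proof -
    \<comment> \<open>By uniqueness it suffices to guess the value \<open>m\<close> and to check its
      quadratic equation.\<close>
    have val: "l = m" if "D x y < m" "m * (m - D x y) = 2 * (D x z)\<^sup>2" for m
    proof -
      have "1 \<le> d x z" using xyz(1) by (intro dist_ge_1) auto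
      then have "perron D {x, y, z} m" using that xyz
        by (intro D_isosceles[where p = "D x y" and q = "D x z"]) auto
      then show ?thesis using l D_unique[of "{x, y, z}" l m] unfolding xyz(2) by simp
    qed
    consider "d x y = 1" "d x z = 1" | "d x y = 1" "d x z = 2"
      | "d x y = 2" "d x z = 1" | "d x y = 2" "d x z = 2"
      using dist_cases[of x y] dist_cases[of x z] xyz(1) by auto
    then show ?thesis
    proof cases
      case 1
      then have "l = 2" by (intro val) auto
      then show ?thesis using sqrt_bounds by simp
    next
      case 2
      then have "l = (1 + sqrt 33) / 2"
        using sqrt_bounds by (intro val) (auto simp: field_simps)
      then show ?thesis by simp
    next
      case 3
      then have "l = 1 + sqrt 3"
        using sqrt_bounds by (intro val) (auto simp: field_simps)
      then show ?thesis using sqrt_bounds by simp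
    next
      case 4
      then have "l = 4" by (intro val) auto
      then show ?thesis using 4 xyz(3) by simp
    qed
  qed
  have ind: "independent3 u v w" if "d u v = 2" "d u w = 2" "d v w = 2"
    using that[THEN dist_eq_2D(2)] ne unfolding independent3_def by auto
  have "d u w = d v w \<or> d u v = d v w \<or> d u v = d u w"
    using dist_cases[of u v] dist_cases[of u w] dist_cases[of v w] ne by auto
  then show ?thesis
  proof (elim disjE)
    assume "d u w = d v w"
    then show ?thesis using iso[of u v w] ne ind by auto
  next
    assume "d u v = d v w"
    then have "d u v = d w v" by (simp add: dist_sym)
    then show ?thesis using iso[of u w v] ne ind dist_sym by auto
  next
    assume "d u v = d u w"
    then have "d v u = d w u" by (simp add: dist_sym)
    then show ?thesis using iso[of v w u] ne ind dist_sym by auto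
  qed
qed

lemma perron_small_cases:
  assumes l: "perron D S l" and "card S \<le> 3"
  shows "l \<le> (1 + sqrt 33) / 2 \<or> (l = 4 \<and> (\<exists>u v w. independent3 u v w))"
proof -
  have "S \<noteq> {}" using l unfolding perron_def by blast
  then have "card S \<noteq> 0" by simp
  then consider "card S = 1" | "card S = 2" | "card S = 3" using assms(2) by linarith
  then show ?thesis
  proof cases
    case 1
    then obtain u where "S = {u}" by (auto simp: card_1_singleton_iff)
    then have "l = 0" using D_unique[OF l] perron_singleton by simp
    then show ?thesis using sqrt_bounds by simp
  next
    case 2
    then obtain u v where "S = {u, v}" "u \<noteq> v" by (auto simp: card_2_iff)
    then have "l = D u v" using D_unique[OF l] perron_pair by simp
    then show ?thesis using dist_cases[OF \<open>u \<noteq> v\<close>] sqrt_bounds by auto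
  next
    case 3
    then obtain u v w where "S = {u, v, w}" "distinct [u, v, w]" by (auto simp: card_3_iff)
    then show ?thesis using perron_triple_cases[of u v w l] l by auto
  qed
qed

text \<open>If at least two of the six pairs are nonadjacent, the distances sum to at least 8 and
  the average bound gives 4. One nonadjacent pair gives a diamond; none gives K4, which is
  excluded.\<close>

lemma perron_four_cases:
  assumes l: "perron D {u, v, w, x} l" and ne: "distinct [u, v, w, x]"
  shows "4 \<le> l \<or> (l = (3 + sqrt 17) / 2 \<and> (\<exists>u v w x. diamond u v w x))"
proof -
  have dia: ?thesis if "diamond a b c e" "{a, b, c, e} = {u, v, w, x}" for a b c e
    using D_unique[OF l] diamond_perron[OF that(1)] that by auto
  have c: "(adj p q \<and> d p q = 1) \<or> (\<not> adj p q \<and> d p q = 2)" if "p \<noteq> q" for p q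
    using diam[OF that] dist_adj by blast
  have cs: "(adj u v \<and> d u v = 1) \<or> (\<not> adj u v \<and> d u v = 2)"
    "(adj u w \<and> d u w = 1) \<or> (\<not> adj u w \<and> d u w = 2)"
    "(adj u x \<and> d u x = 1) \<or> (\<not> adj u x \<and> d u x = 2)"
    "(adj v w \<and> d v w = 1) \<or> (\<not> adj v w \<and> d v w = 2)"
    "(adj v x \<and> d v x = 1) \<or> (\<not> adj v x \<and> d v x = 2)"
    "(adj w x \<and> d w x = 1) \<or> (\<not> adj w x \<and> d w x = 2)"
    using ne c[of u v] c[of u w] c[of u x] c[of v w] c[of v x] c[of w x] by simp_all
  have avg: "D u v + D u w + D u x + D v w + D v x + D w x \<le> 2 * l"
    by (rule perron_ge_average4[OF l ne order.refl])
  have comm: "adj p q \<longleftrightarrow> adj q p" for p q using adj_sym by blast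
  have "4 \<le> l \<or> clique4 u v w x \<or> diamond u v w x \<or> diamond u w v x \<or> diamond u x v w
    \<or> diamond v w u x \<or> diamond v x u w \<or> diamond w x u v"
    unfolding clique4_def diamond_def using cs
    by (elim disjE conjE) (use avg ne in \<open>simp_all add: comm\<close>)
  then show ?thesis
    using K4_free dia[of u v w x] dia[of u w v x] dia[of u x v w] dia[of v w u x]
      dia[of v x u w] dia[of w x u v] by (auto simp: insert_commute)
qed

lemma perron_large_cases:
  assumes l: "perron D S l" and "4 \<le> card S"
  shows "4 \<le> l \<or> (l = (3 + sqrt 17) / 2 \<and> (\<exists>u v w x. diamond u v w x))"
proof (cases "card S = 4")
  case True
  then obtain u v w x where "S = {u, v, w, x}" "distinct [u, v, w, x]"
    by (auto simp: card_Suc_eq numeral_eq_Suc)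
  then show ?thesis using perron_four_cases[of u v w x l] l by simp
next
  case False
  then have "5 \<le> card S" using assms(2) by simp
  then show ?thesis using card_le_perron[OF l] by linarith
qed

lemma perron_cases:
  assumes "perron D S l"
  shows "l \<le> (1 + sqrt 33) / 2 \<or> 4 \<le> l \<or> (l = (3 + sqrt 17) / 2 \<and> (\<exists>u v w x. diamond u v w x))"
proof (cases "card S \<le> 3")
  case True
  then show ?thesis using perron_small_cases[OF assms] by auto
next
  case False
  then have "4 \<le> card S" by simp
  then show ?thesis using perron_large_cases[OF assms] by blast
qed

section \<open>Four-vertex submatrices of the pentagon and the bowtie\<close>

lemma perron_induced_path:
  assumes "u \<noteq> w" "u \<noteq> x" "v \<noteq> x"
    and "adj u v" "adj v w" "adj w x" "\<not> adj u w" "\<not> adj u x" "\<not> adj v x"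
  shows "perron D {u, v, w, x} ((3 + sqrt 37) / 2)"
proof -
  have "d u v = 1" "d u w = 2" "d u x = 2" "d v w = 1" "d v x = 2" "d w x = 1"
    "d x v = 2" "d x w = 1" "distinct [u, x, v, w]"
    using assms diam by (auto simp: dist_adj dist_sym[of x] adj_commute[of x])
  \<comment> \<open>The pairs are the two ends and the two middle vertices, with equation
    \<open>(l - 2) * (l - 1) = 9\<close>. The ends are at distance 2, through a vertex outside the
    path.\<close>
  then have "perron D {u, x, v, w} ((3 + sqrt 37) / 2)" using sqrt_bounds
    by (intro D_two_pairs[where p = 2 and r = 1 and s = 3])
      (auto simp: field_simps power2_eq_square)
  moreover have "{u, x, v, w} = {u, v, w, x}" by blast
  ultimately show ?thesis by simp
qed

text \<open>Any four vertices of a five-cycle induce a path, and monotonicity carries its value to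
  \<open>S\<close>.\<close>

lemma pentagon_large:
  assumes P: "pentagon a b c e f" and l: "perron D S l" and S: "4 \<le> card S"
  shows "(3 + sqrt 37) / 2 \<le> l"
proof -
  have ge: "(3 + sqrt 37) / 2 \<le> l" if "perron D T ((3 + sqrt 37) / 2)" "T \<subseteq> S" for T
    using D_mono[OF that(2) l that(1)] .
  note U = conjunct1[OF P[unfolded pentagon_def]] and P' = conjunct2[OF P[unfolded pentagon_def]]
  have p: "perron D {a, b, c, e} ((3 + sqrt 37) / 2)" "perron D {b, c, e, f} ((3 + sqrt 37) / 2)"
    "perron D {c, e, f, a} ((3 + sqrt 37) / 2)" "perron D {e, f, a, b} ((3 + sqrt 37) / 2)"
    "perron D {f, a, b, c} ((3 + sqrt 37) / 2)"
    by (rule perron_induced_path; use P' in \<open>auto simp: adj_commute\<close>)+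
  moreover have "{a, b, c, e} \<subseteq> S \<or> {a, b, c, f} \<subseteq> S \<or> {a, b, e, f} \<subseteq> S \<or> {a, c, e, f} \<subseteq> S
    \<or> {b, c, e, f} \<subseteq> S" using P' by (intro four_subset_of_five[OF U _ S]) (rule conjunct1)
  ultimately show ?thesis using p[THEN ge] by blast
qed

abbreviation (input) gamma :: real where
  "gamma \<equiv> Max {x::real. x^3 - x^2 - 11 * x - 7 = 0}"

lemma perron_induced_paw:
  assumes "u \<noteq> p" "v \<noteq> p"
    and "adj c u" "adj c v" "adj u v" "adj c p" "\<not> adj u p" "\<not> adj v p"
  shows "perron D {c, u, v, p} gamma"
proof -
  have "d c u = 1" "d c v = 1" "d u v = 1" "d c p = 1" "d u p = 2" "d v p = 2"
    "distinct [c, u, v, p]"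
    using assms diam by (auto simp: dist_adj)
  then show ?thesis using Max_cubic_roots by (intro D_paw) auto
qed

text \<open>Four vertices including the centre \<open>a\<close> induce a triangle with a pendant
  edge, of value \<open>gamma\<close>. The other four have distances summing to 10, so there the
  average bound gives 5, which exceeds \<open>gamma\<close>.\<close>

lemma bowtie_large:
  assumes B: "bowtie a b c e f" and l: "perron D S l" and S: "4 \<le> card S"
  shows "gamma \<le> l"
proof -
  have ge: "gamma \<le> l" if "perron D T gamma" "T \<subseteq> S" for T
    using D_mono[OF that(2) l that(1)] .
  note U = conjunct1[OF B[unfolded bowtie_def]] and B' = conjunct2[OF B[unfolded bowtie_def]]
  have p: "perron D {a, b, c, e} gamma" "perron D {a, b, c, f} gamma"
    "perron D {a, e, f, b} gamma" "perron D {a, e, f, c} gamma"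
    by (rule perron_induced_paw; use B' in \<open>auto simp: adj_commute\<close>)+
  moreover have "gamma \<le> l" if "{b, c, e, f} \<subseteq> S"
  proof -
    have "distinct [b, c, e, f]" "d b c = 1" "d b e = 2" "d b f = 2" "d c e = 2" "d c f = 2" "d e f = 1"
      using B' diam by (auto simp: dist_adj)
    then show ?thesis using perron_ge_average4[OF l _ that] Max_cubic_roots(3) by auto
  qed
  moreover have "{a, b, c, e} \<subseteq> S \<or> {a, b, c, f} \<subseteq> S \<or> {a, b, e, f} \<subseteq> S \<or> {a, c, e, f} \<subseteq> S
    \<or> {b, c, e, f} \<subseteq> S" using B' by (intro four_subset_of_five[OF U _ S]) (rule conjunct1)
  ultimately show ?thesis using p[THEN ge] by blast
qed

text \<open>The nonadjacent \<open>u\<close>, \<open>v\<close> have exactly one common neighbour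
  \<open>w\<close>, and every other vertex is adjacent to exactly one of them. Each of
  \<open>u\<close> and \<open>v\<close> turns out to have exactly one further neighbour, so there
  are five vertices and few edges left to decide.\<close>

lemma pentagon_or_bowtie:
  assumes n: "5 \<le> CARD('n)" and nonadj: "u \<noteq> v" "\<not> adj u v"
    and no_diamond: "\<And>u v w x. \<not> diamond u v w x"
    and no_C4: "\<And>u v w x. \<not> induced_C4 u v w x"
    and no_ind: "\<And>u v w. \<not> independent3 u v w"
  shows "(\<exists>a b c e f. pentagon a b c e f) \<or> (\<exists>a b c e f. bowtie a b c e f)"
proof -
  \<comment> \<open>Two common neighbours would form a diamond if adjacent and an induced four-cycle
    if not.\<close>
  have common: "y = z" if "p \<noteq> q" "\<not> adj p q" "adj p y" "adj q y" "adj p z" "adj q z" for p q y z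
    using no_diamond[of p q y z] no_C4[of p q y z] that unfolding diamond_def induced_C4_def by blast
  have ind: "adj p q" if "p \<noteq> q" "r \<noteq> p" "r \<noteq> q" "\<not> adj r p" "\<not> adj r q" for p q r
    using no_ind[of r p q] that unfolding independent3_def by blast
  \<comment> \<open>An edge lies in at most one triangle: the third vertices of two would give K4 if
    adjacent and a diamond if not.\<close>
  have triangle: False if "adj p q" "adj p r" "adj q r" "adj p s" "adj q s" "r \<noteq> s" for p q r s
    using no_diamond[of r s p q] K4_free[of p q r s] that adj_sym
    unfolding diamond_def clique4_def by blast
  obtain w where w: "adj u w" "adj v w" using common_neighbour[OF nonadj] adj_sym by blast
  let ?A = "{x. adj u x \<and> x \<noteq> w}" and ?C = "{x. adj v x \<and> x \<noteq> w}"
  have A: "\<not> adj v x" "x \<noteq> u" "x \<noteq> v" if "x \<in> ?A" for x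
    using that common[OF nonadj w, of x] nonadj by auto
  have C: "\<not> adj u x" "x \<noteq> u" "x \<noteq> v" if "x \<in> ?C" for x
    using that common[OF nonadj w, of x] nonadj adj_sym by auto
  have cover: "x \<in> {u, v, w} \<union> ?A \<union> ?C" for x
    using ind[of u v x] nonadj adj_sym by blast
  have UN: "UNIV = {u, v, w} \<union> ?A \<union> ?C" using cover by blast
  \<comment> \<open>Stated for \<open>p\<close>, \<open>q\<close> because it is applied to
    \<open>u\<close>, \<open>v\<close> in both orders.\<close>
  have side: "\<exists>a. {x. adj p x \<and> x \<noteq> w} = {a}"
    if pq: "p \<noteq> q" "\<not> adj p q" "adj p w" "adj q w"
      and cov: "\<And>x. x \<in> {p, q, w} \<or> adj p x \<or> adj q x" for p q
  proof -
    have nq: "\<not> adj q x" "x \<noteq> q" "x \<noteq> p" if "adj p x" "x \<noteq> w" for x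
    proof -
      show "\<not> adj q x" using common[OF pq that(1)] that(2) by blast
      show "x \<noteq> q" using that(1) pq(2) by blast
      show "x \<noteq> p" using that(1) not_adj_self by blast
    qed
    have "\<exists>a. adj p a \<and> a \<noteq> w"
    proof (rule ccontr)
      assume "\<not> ?thesis"
      then have e: "x = w" if "adj p x" for x using that by blast
      \<comment> \<open>If \<open>w\<close> is the only neighbour of \<open>p\<close>, it is the
        common neighbour of \<open>p\<close> and \<open>x\<close>. All further neighbours of
        \<open>q\<close> then form triangles on the edge from \<open>q\<close> to \<open>w\<close>,
        so there is at most one and the graph has at most four vertices.\<close>
      have qn: "adj w x" if x: "adj q x" "x \<noteq> w" for x
      proof -
        have "x \<noteq> p" using x(1) pq(2) adj_sym by blast
        moreover have "\<not> adj p x" using e x(2) by blast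
        ultimately obtain y where "adj p y" "adj y x" using common_neighbour[of p x] by blast
        then show ?thesis using e by blast
      qed
      have le1: "x = y" if x: "adj q x" "x \<noteq> w" and y: "adj q y" "y \<noteq> w" for x y
        by (rule ccontr) (rule triangle[OF pq(4) x(1) qn[OF x] y(1) qn[OF y]])
      \<comment> \<open>If \<open>q\<close> has no further neighbour, \<open>c\<close> is arbitrary;
        the four-element cover below still holds.\<close>
      define c where "c = (SOME x. adj q x \<and> x \<noteq> w)"
      have "x = c" if x: "adj q x" "x \<noteq> w" for x
      proof -
        have "adj q c \<and> c \<noteq> w" 
          unfolding c_def by (rule someI[of "\<lambda>x. adj q x \<and> x \<noteq> w"]) (use x in simp)
        then show ?thesis using le1[OF x, of c] by simp
      qed
      then have "x \<in> {p, q, w, c}" for x using cov[of x] e[of x] by blast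
      then have "UNIV \<subseteq> {p, q, w, c}" by blast
      then have "CARD('n) \<le> card {p, q, w, c}" by (intro card_mono) auto
      also have "\<dots> \<le> 4" by (simp add: card_insert_if)
      finally show False using n by simp
    qed
    then obtain a where a: "adj p a" "a \<noteq> w" by blast
    \<comment> \<open>A second further neighbour \<open>b\<close> is adjacent to \<open>a\<close>,
      and neither is adjacent to \<open>w\<close>. A common neighbour \<open>y\<close> of
      \<open>a\<close> and \<open>q\<close> is then nonadjacent to \<open>p\<close> and to
      \<open>w\<close>, which forces \<open>y\<close> adjacent to \<open>b\<close>. So
      \<open>p\<close> and \<open>y\<close> share both \<open>a\<close> and \<open>b\<close>, a
      contradiction.\<close>
    have "b = a" if b: "adj p b" "b \<noteq> w" for b
    proof (rule ccontr)
      assume ne: "b \<noteq> a"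
      have ab: "adj a b" by (rule ind[of a b q]) (use ne nq[OF a] nq[OF b] in blast)+
      have wa: "\<not> adj a w"
        by (rule notI) (rule triangle[OF a(1) b(1) ab pq(3) _ b(2)])
      have wb: "\<not> adj b w"
        by (rule notI) (rule triangle[OF b(1) a(1) adj_sym[OF ab] pq(3) _ a(2)])
      obtain y where y: "adj a y" "adj y q"
        using common_neighbour[of a q] nq[OF a] adj_sym by blast
      have yw: "y \<noteq> w" using y(1) wa by blast
      have py: "\<not> adj p y" using nq[of y] y(2) yw adj_sym by blast
      have yp: "p \<noteq> y" using y(2) pq(2) by blast
      have ya: "adj y a" using y(1) by (rule adj_sym)
      have wy: "\<not> adj y w"
      proof
        assume "adj y w"
        then have "a = w" by (rule common[OF yp py a(1) ya pq(3)])
        then show False using a(2) by simp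
      qed
      have "y \<noteq> b" using py b(1) by blast
      then have "adj y b"
        by (intro ind[of y b w]) (use wy wb yw b(2) adj_sym in blast)+
      then have "a = b" by (rule common[OF yp py a(1) ya b(1)])
      then show False using ne by simp
    qed
    then have "{x. adj p x \<and> x \<noteq> w} = {a}" using a by blast
    then show ?thesis by blast
  qed
  have covuv: "x \<in> {u, v, w} \<or> adj u x \<or> adj v x" for x using cover[of x] by blast
  obtain a where a: "?A = {a}" using side[OF nonadj w covuv] by blast
  have "x \<in> {v, u, w} \<or> adj v x \<or> adj u x" for x using cover[of x] by blast
  then obtain c where c: "?C = {c}" using side[of v u] nonadj w adj_sym by blast
  have U: "UNIV = {u, v, w, a, c}" using UN unfolding a c by auto
  have aA: "adj u a" "a \<noteq> w" "\<not> adj v a" "a \<noteq> u" "a \<noteq> v"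
    using a A[of a] by auto
  have cC: "adj v c" "c \<noteq> w" "\<not> adj u c" "c \<noteq> u" "c \<noteq> v"
    using c C[of c] by auto
  have ac: "a \<noteq> c" using aA cC by blast
  have ne: "u \<noteq> w" "v \<noteq> w" using w by auto
  show ?thesis
  proof (cases "adj a w")
    case True
    have "\<not> adj a c"
      using common[of a v w c] True aA cC w adj_sym by blast
    \<comment> \<open>The only neighbours of \<open>u\<close> are \<open>w\<close> and
      \<open>a\<close>, so \<open>y\<close> must be \<open>w\<close>, the centre of the
      bowtie.\<close>
    obtain y where y: "adj c y" "adj y u" using common_neighbour[of c u] cC adj_sym by blast
    have "y \<in> {w, a}" using y a adj_sym by blast
    then have "adj c w" using y \<open>\<not> adj a c\<close> adj_sym by blast
    then have "bowtie w u a v c"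
      unfolding bowtie_def using U nonadj w aA cC ac ne True \<open>\<not> adj a c\<close>
      by (auto simp: adj_commute)
    then show ?thesis by blast
  next
    case False
    \<comment> \<open>The only neighbours of \<open>v\<close> are \<open>w\<close> and
      \<open>c\<close>, so \<open>y\<close> must be \<open>c\<close>, which closes the
      five-cycle.\<close>
    obtain y where y: "adj a y" "adj y v" using common_neighbour[of a v] aA adj_sym by blast
    have "y \<in> {w, c}" using y c adj_sym by blast
    then have ac': "adj a c" using y False by blast
    have "\<not> adj c w" using common[of c u a w] cC aA w ac' adj_sym by blast
    then have "pentagon u a c v w"
      unfolding pentagon_def using U nonadj w aA cC ac ne False ac'
      by (auto simp: adj_commute)
    then show ?thesis by blast
  qed
qed

section \<open>The sixth smallest eigenvalue\<close>

lemma mu_6: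
  assumes mu: "is_mu 5 G ((1 + sqrt 33) / 2)"
    and m: "m \<in> spectrum" "(1 + sqrt 33) / 2 < m"
    and gap: "\<And>S l. perron D S l \<Longrightarrow> l \<le> (1 + sqrt 33) / 2 \<or> m \<le> l"
  shows "is_mu 6 G m"
  using is_kth_smallest_Suc[OF mu[unfolded is_mu_def] m] gap
  unfolding is_mu_def spectrum_iff by auto

end

theorem theorem5p6:
  fixes G :: "'n::finite pair_pre_digraph"
  assumes "pair_graph G"
    and "pverts G = UNIV"
    and "Digraph_Component.connected (with_proj G)"
    and "CARD('n) \<ge> 5"
    and "is_mu 5 G ((1 + sqrt 33) / 2)"
  shows "is_mu 6 G
    (if isomorphic G (cycle_graph 5) then (3 + sqrt 37) / 2
     else if isomorphic G C3_coalescence_C3 then Max {x::real. x^3 - x^2 - 11 * x - 7 = 0}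
     else if has_induced G K4_minus_e then (3 + sqrt 17) / 2
     else 4)"
proof -
  interpret spanning_connected_graph G
    using assms(1-3) by (simp add: spanning_connected_graph_def spanning_connected_graph_axioms_def)
  note no3 = three_not_eigenvalue[OF assms(5)]
  interpret diameter_2_K4_free G
  proof unfold_locales
    fix u v :: 'n assume uv: "u \<noteq> v" "\<not> adj u v"
    have "2 \<le> d u v" using uv dist_ge_1[of u v] dist_eq_1_iff[of u v] by linarith
    moreover have "\<not> 3 \<le> d u v"
    proof
      \<comment> \<open>Some vertex is then at distance exactly 3 from \<open>u\<close>, and this
        pair has the excluded value 3.\<close>
      assume "3 \<le> d u v"
      then obtain w where w: "d u w = 3" using ex_dist_eq by blast
      then have "u \<noteq> w" using dist_eq_0_iff[of u w] by linarith
      from perron_pair[OF this] w have "perron D {u, w} 3" by simp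
      then show False using no3 spectrumI by blast
    qed
    ultimately show "d u v = 2" by linarith
  next
    show "\<not> clique4 u v w x" for u v w x using no3 clique4_imp_three by blast
  qed
  have mem: "(1 + sqrt 33) / 2 \<in> spectrum"
    using assms(5) unfolding is_mu_def is_kth_smallest_def by blast
  consider (pentagon) "isomorphic G (cycle_graph 5)"
    | (bowtie) "\<not> isomorphic G (cycle_graph 5)" "isomorphic G C3_coalescence_C3"
    | (diamond) "\<not> isomorphic G (cycle_graph 5)" "\<not> isomorphic G C3_coalescence_C3"
        "has_induced G K4_minus_e"
    | (other) "\<not> isomorphic G (cycle_graph 5)" "\<not> isomorphic G C3_coalescence_C3"
        "\<not> has_induced G K4_minus_e" by blast
  then show ?thesis
  proof cases
    case pentagon
    then obtain a b c e f where P: "pentagon a b c e f"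
      unfolding isomorphic_cycle_graph_5_iff by blast
    have "is_mu 6 G ((3 + sqrt 37) / 2)"
    proof (rule mu_6[OF assms(5)])
      show "(3 + sqrt 37) / 2 \<in> spectrum"
        using perron_induced_path[of a c e b] conjunct2[OF P[unfolded pentagon_def]]
        by (intro spectrumI) auto
      show "(1 + sqrt 33) / 2 < (3 + sqrt 37) / 2" using sqrt_bounds by simp
      show "l \<le> (1 + sqrt 33) / 2 \<or> (3 + sqrt 37) / 2 \<le> l" if "perron D S l" for S l
      proof (cases "card S \<le> 3")
        case True
        then show ?thesis using perron_small_cases[OF that] pentagon_no_independent3[OF P] by blast
      next
        case False
        then have "4 \<le> card S" by simp
        then show ?thesis using pentagon_large[OF P that] by blast
      qed
    qed
    with pentagon show ?thesis by simp
  next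
    case bowtie
    then obtain a b c e f where B: "bowtie a b c e f"
      unfolding isomorphic_C3_coalescence_C3_iff by blast
    have "is_mu 6 G gamma"
    proof (rule mu_6[OF assms(5)])
      show "gamma \<in> spectrum"
        using perron_induced_paw[of b e c a] conjunct2[OF B[unfolded bowtie_def]]
        by (intro spectrumI) auto
      show "(1 + sqrt 33) / 2 < gamma" using sqrt_bounds Max_cubic_roots(2) by simp
      show "l \<le> (1 + sqrt 33) / 2 \<or> gamma \<le> l" if "perron D S l" for S l
      proof (cases "card S \<le> 3")
        case True
        then show ?thesis using perron_small_cases[OF that] bowtie_no_independent3[OF B] by blast
      next
        case False
        then have "4 \<le> card S" by simp
        then show ?thesis using bowtie_large[OF B that] by blast
      qed
    qed
    with bowtie show ?thesis by simp
  next
    case diamond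
    then obtain u v w x where dia: "diamond u v w x"
      unfolding has_induced_K4_minus_e_iff by blast
    have "is_mu 6 G ((3 + sqrt 17) / 2)"
    proof (rule mu_6[OF assms(5)])
      show "(3 + sqrt 17) / 2 \<in> spectrum" using diamond_perron[OF dia] by (rule spectrumI)
      show "(1 + sqrt 33) / 2 < (3 + sqrt 17) / 2" by (rule sqrt_33_less)
      \<comment> \<open>The diamond value lies below 4, so it comes first whether or not 4
        occurs.\<close>
      show "l \<le> (1 + sqrt 33) / 2 \<or> (3 + sqrt 17) / 2 \<le> l" if "perron D S l" for S l
        using perron_cases[OF that] sqrt_bounds by auto
    qed
    with diamond show ?thesis by simp
  next
    case other
    then have no_dia: "\<And>u v w x. \<not> diamond u v w x"
      unfolding has_induced_K4_minus_e_iff by blast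
    have "is_mu 6 G 4"
    proof (rule mu_6[OF assms(5)])
      obtain u v where "u \<noteq> v" "\<not> adj u v" using ex_nonadjacent[OF mem] by blast
      \<comment> \<open>The pentagon and the bowtie are excluded in this case, so an independent
        triple or an induced four-cycle exists.\<close>
      from pentagon_or_bowtie[OF assms(4) this no_dia]
      obtain u v w x where "independent3 u v w \<or> induced_C4 u v w x"
        using other unfolding isomorphic_cycle_graph_5_iff isomorphic_C3_coalescence_C3_iff by blast
      then show "4 \<in> spectrum" by (rule four_in_spectrum)
      show "(1 + sqrt 33) / 2 < 4" using sqrt_bounds by simp
      show "l \<le> (1 + sqrt 33) / 2 \<or> 4 \<le> l" if "perron D S l" for S l
        using perron_cases[OF that] no_dia by auto
    qed
    with other show ?thesis by simp
  qed
qed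

end
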